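(* Let $N\in\mathbb N$ and let $\Phi$ be a real $N\times N$ matrix with spectrum $\sigma$. Let $\varepsilon=(\varepsilon_t)_{t\in\mathbb Z}$ be a subexponential sequence of real $N\times 1$ vectors. Let $x=(x_t)_{t\in\mathbb Z}$ be a sequence of real $N\times 1$ vectors. Then $x_t=P_{<1}x_t+P_{\leftarrow}x_t+P_{\leftrightarrow}x_t$ for each $t\in\mathbb Z$, and the series $\sum_{k=0}^\infty\Phi^kP_{<1}\varepsilon_{t-k}$ and $\sum_{k=1}^\infty\Phi^{-k}P_{\leftarrow}\varepsilon_{t+k}$ converge for each $t\in\mathbb Z$. The following two statements are equivalent. (i) $x_t=\Phi x_{t-1}+\varepsilon_t$ for each $t\in\mathbb Z$. (ii) There exist real vectors $v_{\rightarrow}\in\mathbb V_{\rightarrow}$, $v_{\leftarrow}\in\mathbb V_{\leftarrow}$ and $v_{\leftrightarrow}\in\mathbb V_{\leftrightarrow}$ such that, for each $t\in\mathbb Z$, $$P_{<1}x_t=\Phi^tv_{\rightarrow}+\sum_{k=0}^\infty\Phi^kP_{<1}\varepsilon_{t-k},$$ $$P_{\leftarrow}x_t=\Phi^tv_{\leftarrow}-\sum_{k=1}^\infty\Phi^{-k}P_{\leftarrow}\varepsilon_{t+k},$$ $$P_{\leftrightarrow}x_t=\sum_{\theta\in\Theta}\sum_{k=1}^{d_\theta}(\Phi-e^{-i\theta}I)^{k-1}P_\theta\big((C_\theta B)^{k-1}(R_\theta v_{\leftrightarrow}+C_\theta\varepsilon)\big)_t.$$ Moreover, if $x_t=\Phi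 x_{t-1}+\varepsilon_t$ for each $t\in\mathbb Z$, then the following two statements are true. (iii) The choices of $v_{\rightarrow}\in\mathbb V_{\rightarrow}$, $v_{\leftarrow}\in\mathbb V_{\leftarrow}$ and $v_{\leftrightarrow}\in\mathbb V_{\leftrightarrow}$ in (ii) are uniquely determined by the equalities $$v_{\rightarrow}=\lim_{n\to\infty}\Phi^nP_{\rightarrow}x_{-n},\qquad v_{\leftarrow}=\lim_{n\to\infty}\Phi^{-n}P_{\leftarrow}x_n,\qquad v_{\leftrightarrow}=P_{\leftrightarrow}x_0$$ (in particular, these limits exist). (iv) If $x$ is subexponential then $v_{\rightarrow}=0$ and $v_{\leftarrow}=0$.
   Context: Sequences are two-sided, indexed by $t\in\mathbb Z$. A sequence $y=(y_t)_{t\in\mathbb Z}$ in $\mathbb R^N$ is called subexponential if $\sum_{t\in\mathbb Z}r^{|t|}\|y_t\|<\infty$ for each $r\in(0,1)$, where $\|\cdot\|$ is the Euclidean norm. Spectral projections. $\sigma\subset\mathbb C$ is the set of complex eigenvalues of $\Phi$. The generalized eigenspace of $\lambda\in\sigma$ is $\{v\in\mathbb C^N:(\Phi-\lambda I)^Nv=0\}$. For $A\subseteq\sigma$, the spectral projection $P_A$ is the $N\times N$ matrix of the projection on the direct sum of the generalized eigenspaces of the eigenvalues in $A$ along the direct sum of the generalized eigenspaces of the eigenvalues in $\sigma\setminus A$ ($P_\emptyset=0$, $P_\sigma=I$). Define - $P_{<1}=P_A$ with $A=\{\lambda\in\sigma:|\lambda|<1\}$; - $P_{\rightarrow}=P_A$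 with $A=\{\lambda\in\sigma:0<|\lambda|<1\}$; - $P_{\leftarrow}=P_A$ with $A=\{\lambda\in\sigma:|\lambda|>1\}$; - $P_{\leftrightarrow}=P_A$ with $A=\{\lambda\in\sigma:|\lambda|=1\}$. These are real matrices, since the sets $A$ are closed under complex conjugation. $\mathbb V_{\rightarrow},\mathbb V_{\leftarrow},\mathbb V_{\leftrightarrow}\subseteq\mathbb R^N$ denote the real column spaces of $P_{\rightarrow},P_{\leftarrow},P_{\leftrightarrow}$ respectively. Let $\Theta=\{\theta\in(-\pi,\pi]:e^{-i\theta}\in\sigma\}$. For $\theta\in\Theta$, $P_\theta=P_{\{e^{-i\theta}\}}$ (a possibly complex matrix), and $d_\theta$ is the index of the eigenvalue $e^{-i\theta}$, i.e. the size of the largest Jordan block associated with $e^{-i\theta}$ in the Jordan normal form of $\Phi$. Negative powers. $\Phi$ is not assumed invertible. For $k\in\mathbb N$, $\Phi^{-k}$ denotes $(\Phi^{\mathrm D})^k$, where $\Phi^{\mathrm D}$ is the Drazin inverse of $\Phi$: the unique $N\times N$ matrix satisfying $\Phi^{\mathrm D}\Phi\Phi^{\mathrm D}=\Phi^{\mathrm D}$, $\Phi^{\mathrm D}\Phi=\Phi\Phi^{\mathrm D}$ and $\Phi^{\mathrm D}\Phi^{N+1}=\Phi^N$. Also $\Phi^0=I$. Operators. Let $\mathbb S$ be the complex linear space of all sequences $(y_t)_{t\in\mathbb Z}$ in $\mathbb C^N$. The backshift operator $B:\mathbb S\to\mathbb S$ is $(By)_t=y_{t-1}$. For $\theta\in(-\pi,\pi]$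 the cumulation operator $C_\theta:\mathbb S\to\mathbb S$ is given by $(C_\theta y)_t=-\sum_{s=0}^{-t-1}e^{-i\theta(t+s)}y_{-s}$ for $t<0$, $(C_\theta y)_0=0$, and $(C_\theta y)_t=\sum_{s=1}^te^{-i\theta(t-s)}y_s$ for $t>0$. The residual operator $R_\theta:\mathbb C^N\to\mathbb S$ is $(R_\theta v)_t=e^{-i\theta t}v$. Zeroth powers of operators and matrices are identities. *)

theory Defs
  imports "HOL-Analysis.Analysis" "Jordan_Normal_Form.Jordan_Normal_Form"
begin

no_notation vec_index (infixl "$" 100)

hide_const (open) Matrix.mat Matrix.row Matrix.rows Matrix.vec
hide_type (open) Matrix.vec

definition subexponential :: "(int \<Rightarrow> real ^ 'n) \<Rightarrow> bool" where
  "subexponential y \<longleftrightarrow> (\<forall>r\<in>{0<..<1}. (\<lambda>t. r ^ nat \<bar>t\<bar> * norm (y t)) summable_on UNIV)"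

text \<open>The power operation of the type class is not usable on \<open>'a ^ 'n ^ 'n\<close>: multiplication there
  is componentwise.\<close>

primrec matpow :: "'a::semiring_1 ^ 'n ^ 'n \<Rightarrow> nat \<Rightarrow> 'a ^ 'n ^ 'n" where
  "matpow A 0 = mat 1"
| "matpow A (Suc k) = A ** matpow A k"

definition drazin :: "real ^ 'n ^ 'n \<Rightarrow> real ^ 'n ^ 'n" where
  "drazin A = (THE D. D ** A ** D = D \<and> D ** A = A ** D \<and>
     D ** matpow A (CARD('n) + 1) = matpow A CARD('n))"

definition matpow_int :: "real ^ 'n ^ 'n \<Rightarrow> int \<Rightarrow> real ^ 'n ^ 'n" where
  "matpow_int A t = (if t \<ge> 0 then matpow A (nat t) else matpow (drazin A) (nat (- t)))"

definition complex_mat :: "real ^ 'n ^ 'n \<Rightarrow> complex ^ 'n ^ 'n" where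
  "complex_mat A = map_matrix complex_of_real A"

definition complex_vec :: "real ^ 'n \<Rightarrow> complex ^ 'n" where
  "complex_vec v = (\<chi> i. complex_of_real (v $ i))"

definition eigenvals :: "complex ^ 'n ^ 'n \<Rightarrow> complex set" where
  "eigenvals M = {z. \<exists>v. v \<noteq> 0 \<and> M *v v = z *s v}"

definition gen_eigenspace :: "complex ^ 'n ^ 'n \<Rightarrow> complex \<Rightarrow> (complex ^ 'n) set" where
  "gen_eigenspace M z = {v. matpow (M - mat z) CARD('n) *v v = 0}"

definition gen_eigenspace_sum :: "complex ^ 'n ^ 'n \<Rightarrow> complex set \<Rightarrow> (complex ^ 'n) set" where
  "gen_eigenspace_sum M A = {(\<Sum>z\<in>A. f z) | f. \<forall>z\<in>A. f z \<in> gen_eigenspace M z}"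

definition spectral_proj :: "complex ^ 'n ^ 'n \<Rightarrow> complex set \<Rightarrow> complex ^ 'n ^ 'n" where
  "spectral_proj M A = (THE P. \<forall>u\<in>gen_eigenspace_sum M A.
     \<forall>w\<in>gen_eigenspace_sum M (eigenvals M - A). P *v (u + w) = u)"

text \<open>For sets of eigenvalues closed under conjugation the spectral projection of a real matrix
  is real; the following is the projection as a matrix over the reals.\<close>

definition real_spectral_proj :: "real ^ 'n ^ 'n \<Rightarrow> complex set \<Rightarrow> real ^ 'n ^ 'n" where
  "real_spectral_proj \<Phi> A = (THE Q. complex_mat Q = spectral_proj (complex_mat \<Phi>) A)"

definition proj_lt1 :: "real ^ 'n ^ 'n \<Rightarrow> real ^ 'n ^ 'n" where
  "proj_lt1 \<Phi> = real_spectral_proj \<Phi> {z \<in> eigenvals (complex_mat \<Phi>). cmod z < 1}"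

definition proj_right :: "real ^ 'n ^ 'n \<Rightarrow> real ^ 'n ^ 'n" where
  "proj_right \<Phi> = real_spectral_proj \<Phi> {z \<in> eigenvals (complex_mat \<Phi>). 0 < cmod z \<and> cmod z < 1}"

definition proj_left :: "real ^ 'n ^ 'n \<Rightarrow> real ^ 'n ^ 'n" where
  "proj_left \<Phi> = real_spectral_proj \<Phi> {z \<in> eigenvals (complex_mat \<Phi>). cmod z > 1}"

definition proj_unit :: "real ^ 'n ^ 'n \<Rightarrow> real ^ 'n ^ 'n" where
  "proj_unit \<Phi> = real_spectral_proj \<Phi> {z \<in> eigenvals (complex_mat \<Phi>). cmod z = 1}"

definition column_space :: "real ^ 'n ^ 'n \<Rightarrow> (real ^ 'n) set" where
  "column_space P = span (columns P)"

definition unit_angles :: "real ^ 'n ^ 'n \<Rightarrow> real set" where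
  "unit_angles \<Phi> = {\<theta> \<in> {-pi<..pi}. exp (- \<i> * complex_of_real \<theta>) \<in> eigenvals (complex_mat \<Phi>)}"

text \<open>The size of the largest Jordan block of \<open>M\<close> for the eigenvalue \<open>z\<close>. Jordan normal forms are
  available for matrices indexed by \<open>{0..<n}\<close>, so the index type is enumerated by \<open>e\<close>. The list
  \<open>bs\<close> of blocks consists of pairs (block size, eigenvalue). Up to order it depends neither on \<open>e\<close>
  nor on the choice of a Jordan normal form.\<close>

definition jordan_block_sizes :: "complex ^ 'n ^ 'n \<Rightarrow> complex \<Rightarrow> nat set" where
  "jordan_block_sizes M z = {m. \<exists>(e :: nat \<Rightarrow> 'n) bs. bij_betw e {0..<CARD('n)} UNIV \<and>
     jordan_nf (Matrix.mat CARD('n) CARD('n) (\<lambda>(i, j). M $ e i $ e j)) bs \<and> (m, z) \<in> set bs}"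

definition eigen_index :: "complex ^ 'n ^ 'n \<Rightarrow> complex \<Rightarrow> nat" where
  "eigen_index M z = Max (jordan_block_sizes M z)"

definition backshift :: "(int \<Rightarrow> complex ^ 'n) \<Rightarrow> int \<Rightarrow> complex ^ 'n" where
  "backshift y = (\<lambda>t. y (t - 1))"

definition cumulation :: "real \<Rightarrow> (int \<Rightarrow> complex ^ 'n) \<Rightarrow> int \<Rightarrow> complex ^ 'n" where
  "cumulation \<theta> y = (\<lambda>t.
     if t < 0 then - (\<Sum>s=0..-t-1. exp (- \<i> * complex_of_real \<theta> * of_int (t + s)) *s y (- s))
     else if t = 0 then 0
     else (\<Sum>s=1..t. exp (- \<i> * complex_of_real \<theta> * of_int (t - s)) *s y s))"

definition residual :: "real \<Rightarrow> complex ^ 'n \<Rightarrow> int \<Rightarrow> complex ^ 'n" where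
  "residual \<theta> v = (\<lambda>t. exp (- \<i> * complex_of_real \<theta> * of_int t) *s v)"

text \<open>The identity for the unit-modulus part holds between real vectors, but the right-hand side is
  composed of complex terms, so it is stated after complexification. In the second identity, the
  series is indexed from 0, with \<open>Suc k\<close> as the index starting from 1.\<close>

definition solution_formulas ::
  "real ^ 'n ^ 'n \<Rightarrow> (int \<Rightarrow> real ^ 'n) \<Rightarrow> (int \<Rightarrow> real ^ 'n) \<Rightarrow>
   real ^ 'n \<Rightarrow> real ^ 'n \<Rightarrow> real ^ 'n \<Rightarrow> bool" where
  "solution_formulas \<Phi> \<epsilon> x vr vl vu \<longleftrightarrow>
     vr \<in> column_space (proj_right \<Phi>) \<and>
     vl \<in> column_space (proj_left \<Phi>) \<and>
     vu \<in> column_space (proj_unit \<Phi>) \<and>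
     (\<forall>t.
        proj_lt1 \<Phi> *v x t =
          matpow_int \<Phi> t *v vr + (\<Sum>k. matpow \<Phi> k *v (proj_lt1 \<Phi> *v \<epsilon> (t - int k))) \<and>
        proj_left \<Phi> *v x t =
          matpow_int \<Phi> t *v vl -
          (\<Sum>k. matpow_int \<Phi> (- int (Suc k)) *v (proj_left \<Phi> *v \<epsilon> (t + int (Suc k)))) \<and>
        complex_vec (proj_unit \<Phi> *v x t) =
          (\<Sum>\<theta>\<in>unit_angles \<Phi>.
             let z = exp (- \<i> * complex_of_real \<theta>) in
             \<Sum>k=1..eigen_index (complex_mat \<Phi>) z.
               (matpow (complex_mat \<Phi> - mat z) (k - 1) ** spectral_proj (complex_mat \<Phi>) {z}) *v
               ((cumulation \<theta> \<circ> backshift) ^^ (k - 1))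
                 (\<lambda>s. residual \<theta> (complex_vec vu) s + cumulation \<theta> (\<lambda>r. complex_vec (\<epsilon> r)) s) t))"

end

theory Submission
  imports Defs "Jordan_Normal_Form.Jordan_Normal_Form_Existence"
begin

no_notation vec_index (infixl "$" 100)

hide_const (open) Matrix.mat Matrix.row Matrix.rows Matrix.vec
hide_type (open) Matrix.vec
hide_fact (open) Matrix.mat_def Matrix.row_def Matrix.rows_def Matrix.vec_def Matrix.vec_eq_iff

text \<open>
  Subtracting from the parts of \<open>x\<close> inside and outside the unit circle the respective series in \<open>\<epsilon>\<close>
  leaves solutions of the homogeneous recurrence \<open>y(t) = \<Phi> y(t - 1)\<close>. The Drazin inverse inverts \<open>\<Phi>\<close>
  on the sum of the generalized eigenspaces of nonzero eigenvalues, so there \<open>y(t) = \<Phi>\<^sup>t y(0)\<close>; on the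
  generalized kernel \<open>y(t) = \<Phi>\<^sup>N y(t - N) = 0\<close>. The powers of \<open>\<Phi>\<close> inside the unit circle, and of the
  Drazin inverse outside, decay exponentially, which beats any subexponential sequence; this makes the
  series converge, and iterating the recurrence gives the limits.

  For the eigenvalue \<open>z = exp (- i \<theta>)\<close> put \<open>Y\<^sub>k = (C\<^sub>\<theta> B)\<^sup>k (R\<^sub>\<theta> v + C\<^sub>\<theta> \<epsilon>)\<close>. Since \<open>C\<^sub>\<theta> y\<close> solves the scalar
  recurrence with coefficient \<open>z\<close>, input \<open>y\<close> and initial value 0, each \<open>Y\<^sub>k\<close> is driven by the shifted
  previous one, and the sum of \<open>(\<Phi> - z)\<^sup>k P\<^sub>\<theta> Y\<^sub>k\<close> over \<open>k < d\<^sub>\<theta>\<close> telescopes to a solution, because the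
  \<open>d\<^sub>\<theta>\<close>-th power of \<open>\<Phi> - z\<close> vanishes on the range of \<open>P\<^sub>\<theta>\<close>.
\<close>

subsection \<open>Powers of square matrices\<close>

lemma matrix_diff_ldistrib: "A ** (B - C) = A ** B - A ** C"
  for A :: "'a::ring_1 ^ 'n ^ 'm"
  by (simp add: matrix_matrix_mult_def vec_eq_iff right_diff_distrib sum_subtractf)

lemma matrix_diff_rdistrib: "(A - B) ** C = A ** C - B ** C"
  for A :: "'a::ring_1 ^ 'n ^ 'm"
  by (simp add: matrix_matrix_mult_def vec_eq_iff left_diff_distrib sum_subtractf)

lemma mat_vec_mult: "mat c *v v = c *s v"
  for v :: "'a::semiring_1 ^ 'n"
proof -
  have "(\<Sum>j\<in>UNIV. (if i = j then c else 0) * v $ j) =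
      (\<Sum>j\<in>UNIV. if i = j then c * v $ j else 0)" for i
    by (rule sum.cong) auto
  then show ?thesis by (simp add: matrix_vector_mult_def mat_def vec_eq_iff)
qed

lemma mat_commute: "mat c ** A = A ** mat c"
  for A :: "'a::field ^ 'n ^ 'n"
  by (simp add: matrix_eq mat_vec_mult vector_scalar_commute flip: matrix_vector_mul_assoc)

lemma matpow_commute:
  assumes "A ** B = B ** A"
  shows "matpow A k ** B = B ** matpow A k"
proof (induction k)
  case (Suc k)
  have "matpow A (Suc k) ** B = A ** (matpow A k ** B)" by (simp add: matrix_mul_assoc)
  also have "\<dots> = (A ** B) ** matpow A k" by (simp only: Suc matrix_mul_assoc)
  also have "\<dots> = B ** matpow A (Suc k)" by (simp add: assms matrix_mul_assoc)
  finally show ?case .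
qed simp

lemma matpow_Suc_right: "matpow A (Suc k) = matpow A k ** A"
  using matpow_commute[of A A k] by simp

lemma matpow_add: "matpow A (j + k) = matpow A j ** matpow A k"
  by (induction j) (simp_all add: matrix_mul_assoc)

lemma matpow_mult_vec_Suc: "matpow A (Suc k) *v v = A *v (matpow A k *v v)"
  by (simp add: matrix_vector_mul_assoc)

subsection \<open>Generalized eigenvectors from a Jordan normal form\<close>

text \<open>Carries matrices indexed by naturals, the setting of Jordan normal forms, to matrices
  indexed by a finite type. Along a bijection \<open>d\<close> onto \<open>{0..<n}\<close> it
  preserves products, the identity and powers, so a Jordan factorization can be transferred.\<close>

definition mat_reindex :: "('n \<Rightarrow> nat) \<Rightarrow> 'a Matrix.mat \<Rightarrow> 'a ^ 'n ^ 'n" where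
  "mat_reindex d X = (\<chi> i j. X $$ (d i, d j))"

lemma mat_reindex_mult:
  fixes d :: "'n::finite \<Rightarrow> nat" and X Y :: "'a::semiring_1 Matrix.mat"
  assumes d: "bij_betw d UNIV {0..<n}" and X: "X \<in> carrier_mat n n" and Y: "Y \<in> carrier_mat n n"
  shows "mat_reindex d (X * Y) = mat_reindex d X ** mat_reindex d Y"
proof -
  have lt: "d i < n" for i using d by (auto simp: bij_betw_def)
  have "(X * Y) $$ (d i, d j) = (\<Sum>k\<in>UNIV. X $$ (d i, d k) * Y $$ (d k, d j))" for i j
  proof -
    have "(X * Y) $$ (d i, d j) = (\<Sum>k\<in>{0..<n}. X $$ (d i, k) * Y $$ (k, d j))"
      using X Y lt by (auto simp: scalar_prod_def intro!: sum.cong)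
    then show ?thesis
      by (simp add: sum.reindex_bij_betw[OF d, of "\<lambda>k. X $$ (d i, k) * Y $$ (k, d j)"])
  qed
  then show ?thesis by (simp add: mat_reindex_def matrix_matrix_mult_def vec_eq_iff)
qed

lemma mat_reindex_one:
  assumes d: "bij_betw d UNIV {0..<n}"
  shows "mat_reindex d (1\<^sub>m n) = mat 1"
proof -
  have "d i < n" for i using d by (auto simp: bij_betw_def)
  moreover have "d i = d j \<longleftrightarrow> i = j" for i j
    using d by (auto simp: bij_betw_def dest: injD)
  ultimately show ?thesis by (simp add: mat_reindex_def mat_def vec_eq_iff)
qed

lemma mat_reindex_pow:
  fixes d :: "'n::finite \<Rightarrow> nat" and X :: "'a::semiring_1 Matrix.mat"
  assumes d: "bij_betw d UNIV {0..<n}" and X: "X \<in> carrier_mat n n"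
  shows "mat_reindex d (X ^\<^sub>m k) = matpow (mat_reindex d X) k"
proof (induction k)
  case 0
  then show ?case using X by (simp add: mat_reindex_one[OF d])
next
  case (Suc k)
  then show ?case
    using X by (simp add: mat_reindex_mult[OF d] matpow_commute)
qed

text \<open>Allows powers of \<open>J - a I\<close> to be computed block by block, because the
  difference is again a Jordan matrix. The entrywise form fits \<open>mat_reindex\<close>.\<close>

lemma jordan_matrix_shift:
  fixes a :: "'a::ring_1"
  assumes "i < sum_list (map fst bs)" "j < sum_list (map fst bs)"
  shows "jordan_matrix (map (\<lambda>p. (fst p, snd p - a)) bs) $$ (i, j) =
    jordan_matrix bs $$ (i, j) - (if i = j then a else 0)"
  using assms
proof (induction bs arbitrary: i j)
  case Nil
  then show ?case by simp
next
  case (Cons p bs)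
  obtain m b where p: "p = (m, b)" by (cases p)
  have s: "sum_list (map (fst \<circ> (\<lambda>p. (fst p, snd p - a))) bs) = sum_list (map fst bs)"
    by (simp add: comp_def)
  have "i - m < sum_list (map fst bs)" if "\<not> i < m" using that Cons.prems p by auto
  moreover have "j - m < sum_list (map fst bs)" if "\<not> j < m" using that Cons.prems p by auto
  moreover have "i - m = j - m \<longleftrightarrow> i = j" if "\<not> i < m" "\<not> j < m" using that by auto
  ultimately show ?case
    using Cons.prems Cons.IH[of "i - m" "j - m"] unfolding p
    by (cases "i < m"; cases "j < m") (simp_all add: jordan_matrix_Cons s)
qed

text \<open>The block \<open>p\<close> is the one whose columns include \<open>j\<close>; outside
  it, column \<open>j\<close> of a block diagonal matrix is zero anyway. As \<open>p\<close> depends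
  on the block sizes alone, it is chosen before \<open>F\<close>: in the application
  \<open>F\<close> consists of powers of shifted blocks, with exponent and shift read off from
  \<open>p\<close>.\<close>

lemma diag_block_zero_column:
  fixes bs :: "(nat \<times> 'a::zero) list"
  assumes "j < sum_list (map fst bs)"
  shows "\<exists>p\<in>set bs. \<forall>F. (\<forall>q. F q \<in> carrier_mat (fst q) (fst q)) \<longrightarrow>
    F p = 0\<^sub>m (fst p) (fst p) \<longrightarrow>
    (\<forall>i<sum_list (map fst bs). diag_block_mat (map F bs) $$ (i, j) = (0::'a))"
  using assms
proof (induction bs arbitrary: j)
  case Nil
  then show ?case by simp
next
  case (Cons q bs)
  have dims: "dim_row (diag_block_mat (map F bs)) = sum_list (map fst bs) \<and>
      dim_col (diag_block_mat (map F bs)) = sum_list (map fst bs)"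
    if "\<forall>q. F q \<in> carrier_mat (fst q) (fst q)" for F :: "nat \<times> 'a \<Rightarrow> 'a Matrix.mat"
  proof -
    have "dim_row (F q) = fst q" "dim_col (F q) = fst q" for q
      using carrier_matD[OF that[rule_format, of q]] by auto
    then show ?thesis by (simp add: dim_diag_block_mat comp_def)
  qed
  show ?case
  proof (cases "j < fst q")
    case True
    show ?thesis
    proof (intro bexI allI impI)
      fix F :: "nat \<times> 'a \<Rightarrow> 'a Matrix.mat" and i
      assume F: "\<forall>q. F q \<in> carrier_mat (fst q) (fst q)" and "F q = 0\<^sub>m (fst q) (fst q)"
        and "i < sum_list (map fst (q # bs))"
      then show "diag_block_mat (map F (q # bs)) $$ (i, j) = 0"
        using True dims[OF F] by (cases "i < fst q") (simp_all add: Let_def)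
    qed simp
  next
    case False
    then have "j - fst q < sum_list (map fst bs)" using Cons.prems by auto
    from Cons.IH[OF this] obtain p where p: "p \<in> set bs"
      and "\<forall>F :: nat \<times> 'a \<Rightarrow> 'a Matrix.mat.
        (\<forall>q. F q \<in> carrier_mat (fst q) (fst q)) \<longrightarrow> F p = 0\<^sub>m (fst p) (fst p) \<longrightarrow>
        (\<forall>i<sum_list (map fst bs). diag_block_mat (map F bs) $$ (i, j - fst q) = 0)"
      by (rule bexE) (rule that, assumption+)
    note IH = this(2)[rule_format]
    show ?thesis
    proof (intro bexI allI impI)
      fix F :: "nat \<times> 'a \<Rightarrow> 'a Matrix.mat" and i
      assume F: "\<forall>q. F q \<in> carrier_mat (fst q) (fst q)" and "F p = 0\<^sub>m (fst p) (fst p)"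
        and i: "i < sum_list (map fst (q # bs))"
      then have z: "diag_block_mat (map F bs) $$ (i - fst q, j - fst q) = 0" if "\<not> i < fst q"
        by (intro IH) (use that in auto)
      show "diag_block_mat (map F (q # bs)) $$ (i, j) = 0"
        using False dims[OF F] Cons.prems i carrier_matD[OF F[rule_format, of q]] z
        by (cases "i < fst q") (simp_all add: Let_def)
    qed (use p in simp)
  qed
qed

text \<open>The block through column \<open>j\<close> has size \<open>m\<close> and eigenvalue
  \<open>a\<close>; after subtracting \<open>a\<close> its \<open>m\<close>-th power is zero. Thus
  the \<open>j\<close>-th unit vector is a generalized eigenvector of the Jordan matrix, with a
  block size as exponent.\<close>

lemma jordan_matrix_column_nilpotent:
  fixes bs :: "(nat \<times> 'a::field) list"
  assumes "j < sum_list (map fst bs)"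
  shows "\<exists>m a. (m, a) \<in> set bs \<and> (\<forall>i<sum_list (map fst bs).
    (jordan_matrix (map (\<lambda>p. (fst p, snd p - a)) bs) ^\<^sub>m m) $$ (i, j) = 0)"
proof -
  obtain p where p: "p \<in> set bs"
    and "\<forall>F :: nat \<times> 'a \<Rightarrow> 'a Matrix.mat. (\<forall>q. F q \<in> carrier_mat (fst q) (fst q)) \<longrightarrow> F p = 0\<^sub>m (fst p) (fst p) \<longrightarrow>
      (\<forall>i<sum_list (map fst bs). diag_block_mat (map F bs) $$ (i, j) = 0)"
    using diag_block_zero_column[OF assms] by (rule bexE) (rule that, assumption+)
  note col = this(2)[rule_format]
  define F where "F q = jordan_block (fst q) (snd q - snd p) ^\<^sub>m fst p" for q
  have FP: "F p = 0\<^sub>m (fst p) (fst p)"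
    unfolding F_def by (rule eq_matI) (auto simp: jordan_block_zero_pow)
  have FC: "F q \<in> carrier_mat (fst q) (fst q)" for q by (simp add: F_def)
  have "jordan_matrix (map (\<lambda>q. (fst q, snd q - snd p)) bs) ^\<^sub>m fst p =
      diag_block_mat (map F bs)"
    by (simp add: jordan_matrix_pow F_def[abs_def] comp_def case_prod_beta)
  then have "\<forall>i<sum_list (map fst bs).
      (jordan_matrix (map (\<lambda>q. (fst q, snd q - snd p)) bs) ^\<^sub>m fst p) $$ (i, j) = 0"
    using col[OF FC FP] by simp
  then show ?thesis using p by (intro exI[of _ "fst p"] exI[of _ "snd p"]) simp
qed

text \<open>The vectors are the columns of the transition matrix to a Jordan normal form. The
  exponents are kept as block sizes, not enlarged to the dimension, because the unit-modulus formula
  stops at \<open>eigen_index\<close>.\<close>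

theorem jordan_basis:
  fixes M :: "complex ^ 'n ^ 'n"
  shows "\<exists>(b :: 'n \<Rightarrow> complex ^ 'n) m a. (\<forall>i. matpow (M - mat (a i)) (m i) *v b i = 0) \<and>
    (\<forall>i. m i \<in> jordan_block_sizes M (a i)) \<and> (\<forall>v. \<exists>c. v = (\<Sum>i\<in>UNIV. c i *s b i))"
proof -
  define n where "n = CARD('n)"
  obtain e :: "nat \<Rightarrow> 'n" where e: "bij_betw e {0..<n} UNIV"
    unfolding n_def using ex_bij_betw_nat_finite[of "UNIV :: 'n set"] by auto
  define d where "d = inv_into {0..<n} e"
  have d: "bij_betw d UNIV {0..<n}" unfolding d_def by (rule bij_betw_inv_into[OF e])
  have dlt: "d i < n" for i using d by (auto simp: bij_betw_def)
  have ed: "e (d i) = i" for i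
    unfolding d_def using e by (metis bij_betw_inv_into_right UNIV_I)
  define X where "X = Matrix.mat n n (\<lambda>(i, j). M $ e i $ e j)"
  have X: "X \<in> carrier_mat n n" by (simp add: X_def)
  have XM: "mat_reindex d X = M" by (simp add: mat_reindex_def X_def dlt ed vec_eq_iff)
  obtain as where "char_poly X = (\<Prod>a\<leftarrow>as. [:- a, 1:])" using char_poly_factorized[OF X] by blast
  then obtain bs where bs: "jordan_nf X bs" using jordan_nf_exists[OF X] by blast
  then obtain P Q where wit: "similar_mat_wit X (jordan_matrix bs) P Q"
    unfolding jordan_nf_def similar_mat_def by blast
  have J: "jordan_matrix bs \<in> carrier_mat n n" and P: "P \<in> carrier_mat n n"
    and Q: "Q \<in> carrier_mat n n" and PQ: "P * Q = 1\<^sub>m n" and QP: "Q * P = 1\<^sub>m n"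
    and XP: "X = P * jordan_matrix bs * Q"
    using wit X unfolding similar_mat_wit_def Let_def by auto
  have sz: "sum_list (map fst bs) = n" using J by auto
  define tP tQ tJ where "tP = mat_reindex d P" and "tQ = mat_reindex d Q"
    and "tJ = mat_reindex d (jordan_matrix bs)"
  have tPQ: "tP ** tQ = mat 1" and tQP: "tQ ** tP = mat 1"
    unfolding tP_def tQ_def
    by (simp_all flip: mat_reindex_mult[OF d P Q] mat_reindex_mult[OF d Q P]
        add: PQ QP mat_reindex_one[OF d])
  have tM: "M = tP ** tJ ** tQ"
    unfolding tP_def tQ_def tJ_def
    using P Q J by (simp flip: mat_reindex_mult[OF d] XM add: XP)
  have "\<exists>m a. (m, a) \<in> set bs \<and> column j (matpow (tJ - mat a) m) = 0" for j
  proof -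
    from jordan_matrix_column_nilpotent[of "d j" bs] dlt[of j] sz
    obtain m a where ma: "(m, a) \<in> set bs" and
      z: "\<forall>i<n. (jordan_matrix (map (\<lambda>p. (fst p, snd p - a)) bs) ^\<^sub>m m) $$ (i, d j) = 0"
      by auto
    let ?J' = "jordan_matrix (map (\<lambda>p. (fst p, snd p - a)) bs)"
    have "map fst (map (\<lambda>p. (fst p, snd p - a)) bs) = map fst bs" by simp
    then have J': "?J' \<in> carrier_mat n n"
      using jordan_matrix_carrier[of "map (\<lambda>p. (fst p, snd p - a)) bs"] sz by metis
    have "?J' $$ (d k, d l) = jordan_matrix bs $$ (d k, d l) - (if k = l then a else 0)" for k l
    proof -
      have "d k = d l \<longleftrightarrow> k = l" using d by (auto simp: bij_betw_def dest: injD)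
      then show ?thesis using jordan_matrix_shift[of "d k" bs "d l" a] dlt sz by simp
    qed
    then have "mat_reindex d ?J' = tJ - mat a"
      unfolding mat_reindex_def tJ_def mat_def vec_eq_iff by simp
    then have "matpow (tJ - mat a) m = mat_reindex d (?J' ^\<^sub>m m)"
      by (simp add: mat_reindex_pow[OF d J'])
    then have "column j (matpow (tJ - mat a) m) = 0"
      using z dlt by (simp add: column_def mat_reindex_def vec_eq_iff)
    then show ?thesis using ma by blast
  qed
  then obtain m a where ma: "\<And>j. (m j, a j) \<in> set bs"
    and col: "\<And>j. column j (matpow (tJ - mat (a j)) (m j)) = 0"
    by metis
  \<comment> \<open>\<open>tP\<close> intertwines \<open>M\<close> and \<open>tJ\<close>, so where a
    shifted power of \<open>tJ\<close> has a zero column, the same shifted power of \<open>M\<close>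
    annihilates the corresponding column of \<open>tP\<close>.\<close>
  have pow: "matpow (M - mat z) k ** tP = tP ** matpow (tJ - mat z) k" for z k
  proof (induction k)
    case (Suc k)
    have "M ** tP = tP ** tJ"
      unfolding tM by (simp add: tQP flip: matrix_mul_assoc)
    then have step: "(M - mat z) ** tP = tP ** (tJ - mat z)"
      by (simp add: matrix_diff_ldistrib matrix_diff_rdistrib mat_commute[of z tP])
    have "matpow (M - mat z) (Suc k) ** tP = (M - mat z) ** (matpow (M - mat z) k ** tP)"
      by (simp add: matrix_mul_assoc)
    also have "\<dots> = ((M - mat z) ** tP) ** matpow (tJ - mat z) k"
      by (simp only: Suc matrix_mul_assoc)
    also have "\<dots> = tP ** matpow (tJ - mat z) (Suc k)"
      by (simp add: step flip: matrix_mul_assoc)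
    finally show ?case .
  qed simp
  show ?thesis
  proof (rule exI[of _ "\<lambda>i. column i tP"], rule exI[of _ m], rule exI[of _ a], intro conjI allI)
    show "matpow (M - mat (a i)) (m i) *v column i tP = 0" for i
    proof -
      have c: "column i (A ** B) = A *v column i B" for A B :: "complex ^ 'n ^ 'n"
        by (simp add: column_def matrix_matrix_mult_def matrix_vector_mult_def vec_eq_iff)
      show ?thesis by (simp flip: c add: pow) (simp add: c col)
    qed
    show "m i \<in> jordan_block_sizes M (a i)" for i
      unfolding jordan_block_sizes_def using e bs ma[of i] by (auto simp: X_def n_def)
    show "\<exists>c. v = (\<Sum>i\<in>UNIV. c i *s column i tP)" for v
    proof -
      have "v = tP *v (tQ *v v)" by (simp add: matrix_vector_mul_assoc tPQ)
      then show ?thesis unfolding matrix_mult_sum[of tP] by blast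
    qed
  qed
qed

text \<open>Serves twice: the maximum in \<open>eigen_index\<close> is over a finite set, and the
  Jordan basis vectors lie in the generalized eigenspaces, whose exponent is the dimension.\<close>

lemma jordan_block_sizes_le:
  fixes M :: "complex ^ 'n ^ 'n"
  assumes "m \<in> jordan_block_sizes M z"
  shows "m \<le> CARD('n)"
proof -
  obtain e :: "nat \<Rightarrow> 'n" and bs where
    "jordan_nf (Matrix.mat CARD('n) CARD('n) (\<lambda>(i, j). M $ e i $ e j)) bs" and bs: "(m, z) \<in> set bs"
    using assms by (auto simp: jordan_block_sizes_def)
  then have "similar_mat (Matrix.mat CARD('n) CARD('n) (\<lambda>(i, j). M $ e i $ e j)) (jordan_matrix bs)"
    by (simp add: jordan_nf_def)
  then have "dim_row (jordan_matrix bs) = CARD('n)"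
    unfolding similar_mat_def similar_mat_wit_def Let_def by auto
  moreover have "m \<le> sum_list (map fst bs)"
    using bs by (intro member_le_sum_list) (auto intro: rev_image_eqI)
  ultimately show ?thesis by simp
qed

lemma jordan_block_size_le_eigen_index:
  assumes "m \<in> jordan_block_sizes M z"
  shows "m \<le> eigen_index M z"
  unfolding eigen_index_def
proof (rule Max_ge)
  show "finite (jordan_block_sizes M z)"
    by (rule finite_subset[OF _ finite_atMost]) (auto dest: jordan_block_sizes_le)
qed (rule assms)

subsection \<open>Decomposition into generalized eigenspaces\<close>

lemma matrix_vector_mult_sum: "A *v (\<Sum>i\<in>I. f i) = (\<Sum>i\<in>I. A *v f i)"
  by (induction I rule: infinite_finite_induct) (simp_all add: matrix_vector_right_distrib)

lemma matrix_sum_vector_mult: "(\<Sum>i\<in>I. A i) *v v = (\<Sum>i\<in>I. A i *v v)"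
  by (induction I rule: infinite_finite_induct) (simp_all add: matrix_vector_mult_add_rdistrib)

lemma matpow_mono_kernel:
  assumes "matpow A j *v v = 0" "j \<le> k"
  shows "matpow A k *v v = 0"
proof -
  have "matpow A k = matpow A (k - j) ** matpow A j"
    using assms by (simp flip: matpow_add)
  then show ?thesis using assms by (simp flip: matrix_vector_mul_assoc)
qed

lemma matpow_eigenvector:
  fixes M :: "'a::field ^ 'n ^ 'n"
  assumes "M *v v = z *s v"
  shows "matpow M k *v v = z ^ k *s v"
  by (induction k)
    (simp_all add: assms vector_scalar_commute vec.scale_left_commute flip: matrix_vector_mul_assoc)

text \<open>By induction on \<open>j\<close>, the vector \<open>(M - z) v\<close> satisfies the
  hypotheses with a smaller exponent and so vanishes. Then \<open>v\<close> is an eigenvector for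
  \<open>z\<close> or zero, and \<open>(M - w)^k\<close> multiplies it by the nonzero number
  \<open>(z - w)^k\<close>.\<close>

lemma kernel_power_disjoint:
  fixes M :: "'a::field ^ 'n ^ 'n"
  assumes "z \<noteq> w" "matpow (M - mat z) j *v v = 0" "matpow (M - mat w) k *v v = 0"
  shows "v = 0"
  using assms(2,3)
proof (induction j arbitrary: v)
  case (Suc j)
  have "matpow (M - mat z) j *v ((M - mat z) *v v) = 0"
    using Suc.prems(1) matpow_Suc_right[of "M - mat z" j] by (simp add: matrix_vector_mul_assoc)
  moreover have "(M - mat w) ** (M - mat z) = (M - mat z) ** (M - mat w)"
    by (simp add: matrix_diff_ldistrib matrix_diff_rdistrib mat_commute[of _ M] mat_commute[of w "mat z"])
  then have "matpow (M - mat w) k *v ((M - mat z) *v v) = 0"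
    using Suc.prems(2) matpow_commute[of "M - mat w" "M - mat z" k]
    by (simp add: matrix_vector_mul_assoc) (simp flip: matrix_vector_mul_assoc)
  ultimately have "(M - mat z) *v v = 0" by (rule Suc.IH)
  then have "M *v v = z *s v" by (simp add: matrix_vector_mult_diff_rdistrib mat_vec_mult)
  then have "(M - mat w) *v v = (z - w) *s v"
    by (simp add: matrix_vector_mult_diff_rdistrib mat_vec_mult vec.scale_left_diff_distrib)
  from matpow_eigenvector[OF this] Suc.prems(2) assms(1) show ?case by simp
qed simp

lemma gen_eigenspace_zero: "0 \<in> gen_eigenspace M z"
  by (simp add: gen_eigenspace_def)

lemma gen_eigenspace_add:
  "u \<in> gen_eigenspace M z \<Longrightarrow> v \<in> gen_eigenspace M z \<Longrightarrow> u + v \<in> gen_eigenspace M z"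
  by (simp add: gen_eigenspace_def matrix_vector_right_distrib)

lemma gen_eigenspace_diff:
  "u \<in> gen_eigenspace M z \<Longrightarrow> v \<in> gen_eigenspace M z \<Longrightarrow> u - v \<in> gen_eigenspace M z"
  by (simp add: gen_eigenspace_def matrix_vector_mult_diff_distrib)

lemma gen_eigenspace_scale: "u \<in> gen_eigenspace M z \<Longrightarrow> c *s u \<in> gen_eigenspace M z"
  by (simp add: gen_eigenspace_def vector_scalar_commute)

lemma gen_eigenspace_sum_mem:
  "(\<And>i. i \<in> I \<Longrightarrow> f i \<in> gen_eigenspace M z) \<Longrightarrow> sum f I \<in> gen_eigenspace M z"
  by (simp add: gen_eigenspace_def matrix_vector_mult_sum)

lemma matpow_diff_mat_commute:
  fixes M :: "'a::field ^ 'n ^ 'n"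
  assumes "B ** M = M ** B"
  shows "matpow (M - mat z) k ** B = B ** matpow (M - mat z) k"
  by (rule matpow_commute)
    (simp add: matrix_diff_ldistrib matrix_diff_rdistrib assms mat_commute[of z B])

lemma gen_eigenspace_commute:
  assumes "B ** M = M ** B" "v \<in> gen_eigenspace M z"
  shows "B *v v \<in> gen_eigenspace M z"
  using assms(2) matpow_diff_mat_commute[OF assms(1), of z "CARD('a)"]
  by (simp add: gen_eigenspace_def matrix_vector_mul_assoc) (simp flip: matrix_vector_mul_assoc)

text \<open>The matrix \<open>R = (M - w)^N\<close> kills the term at \<open>w\<close> and maps the
  other generalized eigenspaces into themselves. The induction hypothesis gives
  \<open>R f(z) = 0\<close> for the remaining \<open>z\<close>, and then \<open>f(z) = 0\<close> by
  \<open>kernel_power_disjoint\<close>.\<close>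

lemma gen_eigenspace_independent:
  assumes "finite A" "\<And>z. z \<in> A \<Longrightarrow> f z \<in> gen_eigenspace M z" "sum f A = 0" "z \<in> A"
  shows "f z = 0"
  using assms
proof (induction A arbitrary: f z rule: finite_induct)
  case (insert w A)
  define R where "R = matpow (M - mat w) CARD('a)"
  have R: "R ** M = M ** R"
    unfolding R_def by (rule matpow_commute) (simp add: matrix_diff_ldistrib matrix_diff_rdistrib mat_commute[of w M])
  have "R *v f w = 0" using insert.prems(1)[of w] by (simp add: R_def gen_eigenspace_def)
  moreover have "R *v (f w + sum f A) = 0" using insert.prems(2) insert.hyps by simp
  ultimately have "(\<Sum>z\<in>A. R *v f z) = 0"
    by (simp add: matrix_vector_mult_sum matrix_vector_right_distrib)
  then have "R *v f z = 0" if "z \<in> A" for z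
    using insert.IH[of "\<lambda>z. R *v f z", OF _ _ that] insert.prems(1) gen_eigenspace_commute[OF R]
    by blast
  then have A: "f z = 0" if "z \<in> A" for z
    using kernel_power_disjoint[of z w M "CARD('a)" "f z" "CARD('a)"] that insert.hyps
      insert.prems(1)[of z] by (auto simp: R_def gen_eigenspace_def)
  then have "f w = 0" using insert.prems(2) insert.hyps by simp
  then show ?case using A insert.prems(3) by blast
qed simp

text \<open>The last nonzero vector of the chain \<open>v\<close>, \<open>(M - z) v\<close>,
  \<open>(M - z)^2 v\<close>, ... is an eigenvector; the least annihilating exponent
  \<open>k\<close> locates it.\<close>

lemma gen_eigenspace_eigenval:
  assumes "v \<in> gen_eigenspace M z" "v \<noteq> 0"
  shows "z \<in> eigenvals M"
proof -
  let ?P = "\<lambda>k. matpow (M - mat z) k *v v = 0"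
  define k where "k = (LEAST k. ?P k)"
  have "?P CARD('a)" using assms(1) by (simp add: gen_eigenspace_def)
  then have k: "?P k" unfolding k_def by (rule LeastI)
  then have "k \<noteq> 0" using assms(2) by (auto intro: ccontr)
  then obtain j where j: "k = Suc j" by (cases k) auto
  have "\<not> ?P j" using not_less_Least[of j ?P] j by (simp add: k_def)
  moreover have "(M - mat z) *v (matpow (M - mat z) j *v v) = 0"
    using k by (simp add: j matrix_vector_mul_assoc)
  then have "M *v (matpow (M - mat z) j *v v) = z *s (matpow (M - mat z) j *v v)"
    by (simp add: matrix_vector_mult_diff_rdistrib mat_vec_mult)
  ultimately show ?thesis unfolding eigenvals_def by blast
qed

text \<open>Groups the Jordan basis by the eigenvalues of its blocks. How \<open>S\<close> relates
  to the spectrum, and that the components are unique, is derived afterwards from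
  independence.\<close>

lemma gen_eigenspace_jordan_basis:
  fixes M :: "complex ^ 'n ^ 'n"
  shows "\<exists>S f. finite S \<and> (\<forall>v z. f v z \<in> gen_eigenspace M z) \<and> (\<forall>v. v = (\<Sum>z\<in>S. f v z)) \<and>
    (\<forall>v z. z \<notin> S \<longrightarrow> f v z = 0) \<and>
    (\<forall>v z. matpow (M - mat z) (eigen_index M z) *v f v z = 0)"
proof -
  obtain b :: "'n \<Rightarrow> complex ^ 'n" and m a
    where b: "\<And>i. matpow (M - mat (a i)) (m i) *v b i = 0"
    and m: "\<And>i. m i \<in> jordan_block_sizes M (a i)"
    and span: "\<And>v. \<exists>c. v = (\<Sum>i\<in>UNIV. c i *s b i)"
    using jordan_basis[of M] by blast
  obtain c where c: "\<And>v. v = (\<Sum>i\<in>UNIV. c v i *s b i)" using span by metis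
  define f where "f v z = (\<Sum>i\<in>{i. a i = z}. c v i *s b i)" for v z
  have "b i \<in> gen_eigenspace M (a i)" for i
    using matpow_mono_kernel[OF b jordan_block_sizes_le[OF m]] by (simp add: gen_eigenspace_def)
  then have 1: "f v z \<in> gen_eigenspace M z" for v z
    unfolding f_def by (auto intro!: gen_eigenspace_sum_mem gen_eigenspace_scale)
  have 2: "v = (\<Sum>z\<in>range a. f v z)" for v
    using sum.image_gen[of UNIV "\<lambda>i. c v i *s b i" a] c[of v] by (simp add: f_def)
  have 3: "f v z = 0" if "z \<notin> range a" for v z
    unfolding f_def using that by (auto intro!: sum.neutral)
  have "matpow (M - mat (a i)) (eigen_index M (a i)) *v b i = 0" for i
    by (rule matpow_mono_kernel[OF b jordan_block_size_le_eigen_index[OF m]])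
  then have 4: "matpow (M - mat z) (eigen_index M z) *v f v z = 0" for v z
    unfolding f_def by (auto simp: matrix_vector_mult_sum vector_scalar_commute intro!: sum.neutral)
  have "finite (range a)" by simp
  then show ?thesis using 1 2 3 4 by (intro exI[of _ "range a"] exI[of _ f]) blast
qed

text \<open>All three claims rest on \<open>eq\<close>: by independence, a generalized eigenvector
  for \<open>z\<close> equals the \<open>z\<close>-component of its own decomposition. Hence the
  exponent \<open>eigen_index M z\<close> kills the whole generalized eigenspace, and every
  eigenvalue lies in the finite set \<open>S\<close>. Components outside the spectrum are zero, so
  the sum shrinks to the eigenvalues.\<close>

lemma
  fixes M :: "complex ^ 'n ^ 'n"
  shows finite_eigenvals: "finite (eigenvals M)"
    and gen_eigenspace_eigen_index:
      "v \<in> gen_eigenspace M z \<Longrightarrow> matpow (M - mat z) (eigen_index M z) *v v = 0"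
    and gen_eigenspace_decomposition:
      "\<exists>f. (\<forall>z\<in>eigenvals M. f z \<in> gen_eigenspace M z) \<and> v = (\<Sum>z\<in>eigenvals M. f z)"
proof -
  obtain S f where S: "finite S"
    and f: "\<And>v z. f v z \<in> gen_eigenspace M z"
    and v: "\<And>v. v = (\<Sum>z\<in>S. f v z)"
    and f0: "\<And>v z. z \<notin> S \<Longrightarrow> f v z = 0"
    and fi: "\<And>v z. matpow (M - mat z) (eigen_index M z) *v f v z = 0"
    using gen_eigenspace_jordan_basis[of M] by blast
  have eq: "v = f v z" if "v \<in> gen_eigenspace M z" for v z
  proof -
    let ?g = "\<lambda>w. f v w - (if w = z then v else 0)"
    have "(\<Sum>w\<in>insert z S. f v w) = v"
      using S f0[of z v] v[of v] by (cases "z \<in> S") (simp_all add: insert_absorb)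
    then have "sum ?g (insert z S) = 0"
      using S by (simp add: sum_subtractf)
    then have "?g z = 0"
      using S f that by (intro gen_eigenspace_independent[of "insert z S" ?g M z])
        (auto simp: gen_eigenspace_zero intro!: gen_eigenspace_diff)
    then show ?thesis by simp
  qed
  show "matpow (M - mat z) (eigen_index M z) *v v = 0" if "v \<in> gen_eigenspace M z" for v z
    using fi[of z v] eq[OF that] by simp
  have "eigenvals M \<subseteq> S"
  proof
    fix z assume "z \<in> eigenvals M"
    then obtain v where ev: "v \<noteq> 0" "M *v v = z *s v" by (auto simp: eigenvals_def)
    then have "(M - mat z) *v v = 0 *s v"
      by (simp add: matrix_vector_mult_diff_rdistrib mat_vec_mult)
    from matpow_eigenvector[OF this, of "CARD('n)"] have "v \<in> gen_eigenspace M z"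
      by (simp add: gen_eigenspace_def)
    then show "z \<in> S" using eq[of v z] f0[of z v] ev(1) by auto
  qed
  then show "finite (eigenvals M)" using S finite_subset by blast
  have "f v z = 0" if "z \<notin> eigenvals M" for v z
    using gen_eigenspace_eigenval[OF f] that by blast
  then have "(\<Sum>z\<in>eigenvals M. f v z) = (\<Sum>z\<in>S. f v z)"
    using S \<open>eigenvals M \<subseteq> S\<close> by (intro sum.mono_neutral_left) auto
  then show "\<exists>f. (\<forall>z\<in>eigenvals M. f z \<in> gen_eigenspace M z) \<and> v = (\<Sum>z\<in>eigenvals M. f z)"
    using f v[of v] by metis
qed

subsection \<open>Spectral projections\<close>

text \<open>Independence makes the chosen function unique on the eigenvalues; elsewhere it is
  unspecified, so the lemmas below assume \<open>z \<in> eigenvals M\<close>.\<close>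

definition gen_part :: "complex ^ 'n ^ 'n \<Rightarrow> complex ^ 'n \<Rightarrow> complex \<Rightarrow> complex ^ 'n" where
  "gen_part M v = (SOME f. (\<forall>z\<in>eigenvals M. f z \<in> gen_eigenspace M z) \<and> v = (\<Sum>z\<in>eigenvals M. f z))"

lemma
  shows gen_part_mem: "z \<in> eigenvals M \<Longrightarrow> gen_part M v z \<in> gen_eigenspace M z"
    and gen_part_sum: "(\<Sum>z\<in>eigenvals M. gen_part M v z) = v"
  using someI_ex[OF gen_eigenspace_decomposition[of M v]] unfolding gen_part_def by auto

lemma gen_part_eqI:
  assumes "\<And>z. z \<in> eigenvals M \<Longrightarrow> f z \<in> gen_eigenspace M z"
    and "v = (\<Sum>z\<in>eigenvals M. f z)" "z \<in> eigenvals M"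
  shows "gen_part M v z = f z"
proof -
  have "gen_part M v z - f z = 0"
    using assms finite_eigenvals gen_part_mem gen_part_sum[of M v]
    by (intro gen_eigenspace_independent[of "eigenvals M" "\<lambda>z. gen_part M v z - f z" M])
      (auto simp: sum_subtractf intro!: gen_eigenspace_diff)
  then show ?thesis by simp
qed

lemma gen_part_add:
  assumes "z \<in> eigenvals M"
  shows "gen_part M (u + v) z = gen_part M u z + gen_part M v z"
  using assms gen_part_mem gen_part_sum[of M u] gen_part_sum[of M v]
  by (intro gen_part_eqI) (auto simp: sum.distrib intro!: gen_eigenspace_add)

text \<open>Generalized eigenspaces are invariant under any \<open>B\<close> that commutes with
  \<open>M\<close>, so applying \<open>B\<close> to the components of \<open>v\<close> gives
  components of \<open>B v\<close>. Commutation of the spectral projections comes from here.\<close>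

lemma gen_part_commute:
  assumes "B ** M = M ** B" "z \<in> eigenvals M"
  shows "gen_part M (B *v v) z = B *v gen_part M v z"
  using assms(2) gen_part_mem gen_part_sum[of M v]
  by (intro gen_part_eqI) (auto intro!: gen_eigenspace_commute[OF assms(1)] simp flip: matrix_vector_mult_sum)

lemma gen_part_scale:
  assumes "z \<in> eigenvals M"
  shows "gen_part M (c *s v) z = c *s gen_part M v z"
  using gen_part_commute[OF mat_commute assms, of c v] by (simp add: mat_vec_mult)

lemma gen_part_of_sum:
  assumes "A \<subseteq> eigenvals M" "\<And>z. z \<in> A \<Longrightarrow> f z \<in> gen_eigenspace M z" "z \<in> eigenvals M"
  shows "gen_part M (\<Sum>z\<in>A. f z) z = (if z \<in> A then f z else 0)"
  using assms finite_eigenvals[of M]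
  by (intro gen_part_eqI) (auto simp: gen_eigenspace_zero Int_absorb1 simp flip: sum.inter_restrict)

text \<open>Replaces the definite description by components. Existence holds because the component
  map is linear and hence has a matrix; uniqueness because every vector splits as
  \<open>u + w\<close>. The algebra of projections below goes through this formula.\<close>

lemma spectral_proj_vec:
  fixes M :: "complex ^ 'n ^ 'n"
  assumes A: "A \<subseteq> eigenvals M"
  shows "spectral_proj M A *v v = (\<Sum>z\<in>A. gen_part M v z)"
proof -
  define P where "P = matrix (\<lambda>v. \<Sum>z\<in>A. gen_part M v z)"
  have "Vector_Spaces.linear (*s) (*s) (\<lambda>v. \<Sum>z\<in>A. gen_part M v z)"
    using A by unfold_locales
      (auto simp: gen_part_add gen_part_scale subset_eq sum.distrib vec.scale_sum_right
        vec.scale_right_distrib vec.scale_left_distrib intro!: sum.cong)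
  then have P: "P *v v = (\<Sum>z\<in>A. gen_part M v z)" for v
    unfolding P_def by (rule matrix_works)
  have "spectral_proj M A = P"
    unfolding spectral_proj_def
  proof (rule the_equality)
    show "\<forall>u\<in>gen_eigenspace_sum M A. \<forall>w\<in>gen_eigenspace_sum M (eigenvals M - A). P *v (u + w) = u"
    proof (intro ballI)
      fix u w assume "u \<in> gen_eigenspace_sum M A" "w \<in> gen_eigenspace_sum M (eigenvals M - A)"
      then obtain f g where f: "\<And>z. z \<in> A \<Longrightarrow> f z \<in> gen_eigenspace M z" "u = (\<Sum>z\<in>A. f z)"
        and g: "\<And>z. z \<in> eigenvals M - A \<Longrightarrow> g z \<in> gen_eigenspace M z"
          "w = (\<Sum>z\<in>eigenvals M - A. g z)"
        unfolding gen_eigenspace_sum_def by blast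
      have "gen_part M (u + w) z = f z" if "z \<in> A" for z
        using that A gen_part_of_sum[of A M f z] gen_part_of_sum[of "eigenvals M - A" M g z] f g
        by (auto simp: gen_part_add)
      then show "P *v (u + w) = u" by (simp add: P f(2))
    qed
    fix P'
    assume P': "\<forall>u\<in>gen_eigenspace_sum M A. \<forall>w\<in>gen_eigenspace_sum M (eigenvals M - A). P' *v (u + w) = u"
    have "P' *v v = P *v v" for v
    proof -
      have "(\<Sum>z\<in>A. gen_part M v z) \<in> gen_eigenspace_sum M A"
        "(\<Sum>z\<in>eigenvals M - A. gen_part M v z) \<in> gen_eigenspace_sum M (eigenvals M - A)"
        unfolding gen_eigenspace_sum_def using A gen_part_mem by blast+
      then have "P' *v ((\<Sum>z\<in>A. gen_part M v z) + (\<Sum>z\<in>eigenvals M - A. gen_part M v z)) =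
          (\<Sum>z\<in>A. gen_part M v z)"
        using P' by blast
      also have "(\<Sum>z\<in>A. gen_part M v z) + (\<Sum>z\<in>eigenvals M - A. gen_part M v z) = v"
        using sum.subset_diff[OF A finite_eigenvals, of "gen_part M v"] gen_part_sum[of M v]
        by (simp add: add.commute)
      finally show ?thesis by (simp add: P)
    qed
    then show "P' = P" by (simp add: matrix_eq)
  qed
  then show ?thesis by (simp add: P)
qed

lemma spectral_proj_singleton_vec:
  "z \<in> eigenvals M \<Longrightarrow> spectral_proj M {z} *v v = gen_part M v z"
  by (simp add: spectral_proj_vec)

lemma spectral_proj_sum:
  assumes "A \<subseteq> eigenvals M"
  shows "spectral_proj M A = (\<Sum>z\<in>A. spectral_proj M {z})"
  using assms
  by (auto simp: matrix_eq spectral_proj_vec matrix_sum_vector_mult subset_eq intro!: sum.cong)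

lemma spectral_proj_commute:
  assumes "A \<subseteq> eigenvals M" "B ** M = M ** B"
  shows "spectral_proj M A ** B = B ** spectral_proj M A"
  unfolding matrix_eq
  using assms
  by (auto simp: spectral_proj_vec matrix_vector_mult_sum gen_part_commute subset_eq
      simp flip: matrix_vector_mul_assoc intro!: sum.cong)

lemma spectral_proj_mult:
  assumes "A \<subseteq> eigenvals M" "B \<subseteq> eigenvals M"
  shows "spectral_proj M A ** spectral_proj M B = spectral_proj M (A \<inter> B)"
proof -
  have "finite A" using assms finite_eigenvals finite_subset by blast
  moreover have "A \<inter> B \<subseteq> eigenvals M" using assms by blast
  moreover have "gen_part M (\<Sum>z\<in>B. gen_part M v z) w = (if w \<in> B then gen_part M v w else 0)"
    if "w \<in> A" for v w
    using that assms by (intro gen_part_of_sum gen_part_mem) auto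
  ultimately show ?thesis
    using assms by (auto simp: matrix_eq spectral_proj_vec sum.inter_restrict simp flip: matrix_vector_mul_assoc)
qed

lemma spectral_proj_Un:
  assumes "A \<subseteq> eigenvals M" "B \<subseteq> eigenvals M" "A \<inter> B = {}"
  shows "spectral_proj M (A \<union> B) = spectral_proj M A + spectral_proj M B"
proof -
  have "finite A" "finite B" using assms finite_eigenvals finite_subset by blast+
  then show ?thesis
    using assms by (simp add: matrix_eq spectral_proj_vec matrix_vector_mult_add_rdistrib sum.union_disjoint)
qed

lemma spectral_proj_empty: "spectral_proj M {} = 0"
  by (simp add: matrix_eq spectral_proj_vec)

lemma spectral_proj_eigenvals: "spectral_proj M (eigenvals M) = mat 1"
  by (simp add: matrix_eq spectral_proj_vec gen_part_sum)

text \<open>The first exponent ends the telescoping sum for eigenvalues of unit modulus; the second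
  is applied to the eigenvalue 0.\<close>

lemma spectral_proj_nilpotent:
  fixes M :: "complex ^ 'n ^ 'n"
  assumes "z \<in> eigenvals M"
  shows "matpow (M - mat z) (eigen_index M z) ** spectral_proj M {z} = 0"
    and "matpow (M - mat z) CARD('n) ** spectral_proj M {z} = 0"
  using assms gen_eigenspace_eigen_index[OF gen_part_mem[OF assms]] gen_part_mem[OF assms]
  by (simp_all add: matrix_eq spectral_proj_singleton_vec gen_eigenspace_def flip: matrix_vector_mul_assoc)

text \<open>The kernel of \<open>M\<close> lies in the generalized eigenspace of 0, which this
  projection annihilates. It yields the invertibility of the matrix \<open>K\<close> from which the
  Drazin inverse is built.\<close>

lemma spectral_proj_nonzero_kernel:
  assumes "M *v v = 0" "spectral_proj M (eigenvals M - {0}) *v v = v"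
  shows "v = 0"
proof -
  have "matpow (M - mat 0) 1 *v v = 0" 
    using assms(1) by (simp add: matrix_vector_mult_diff_rdistrib mat_vec_mult)
  then have v: "v \<in> gen_eigenspace M 0"
    unfolding gen_eigenspace_def mem_Collect_eq by (rule matpow_mono_kernel) simp
  show ?thesis
  proof (cases "0 \<in> eigenvals M")
    case True
    then have "gen_part M (\<Sum>z\<in>{0}. v) z = (if z \<in> {0} then v else 0)" if "z \<in> eigenvals M" for z
      using True v that gen_part_of_sum[of "{0}" M "\<lambda>_. v" z] by auto
    then have "spectral_proj M (eigenvals M - {0}) *v v = 0"
      by (simp add: spectral_proj_vec)
    then show ?thesis using assms(2) by simp
  next
    case False
    then show ?thesis using v gen_eigenspace_eigenval by blast
  qed
qed

subsection \<open>Real matrices\<close>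

lemma complex_vec_component [simp]: "complex_vec v $ i = complex_of_real (v $ i)"
  by (simp add: complex_vec_def)

lemma complex_mat_component [simp]: "complex_mat A $ i $ j = complex_of_real (A $ i $ j)"
  by (simp add: complex_mat_def map_matrix_def)

lemma complex_vec_inject [simp]: "complex_vec u = complex_vec v \<longleftrightarrow> u = v"
  by (simp add: vec_eq_iff)

lemma complex_mat_inject [simp]: "complex_mat A = complex_mat B \<longleftrightarrow> A = B"
  by (simp add: vec_eq_iff)

lemma complex_vec_simps [simp]:
  "complex_vec 0 = 0" "complex_vec (u + v) = complex_vec u + complex_vec v"
  "complex_vec (u - v) = complex_vec u - complex_vec v"
  by (simp_all add: vec_eq_iff)

lemma complex_mat_simps [simp]:
  "complex_mat 0 = 0" "complex_mat (mat 1) = mat 1"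
  "complex_mat (A + B) = complex_mat A + complex_mat B"
  "complex_mat (A - B) = complex_mat A - complex_mat B"
  by (simp_all add: vec_eq_iff mat_def)

lemma complex_mat_mult: "complex_mat (A ** B) = complex_mat A ** complex_mat B"
  by (simp add: vec_eq_iff matrix_matrix_mult_def)

lemma complex_mat_vec: "complex_vec (A *v v) = complex_mat A *v complex_vec v"
  by (simp add: vec_eq_iff matrix_vector_mult_def)

lemma complex_mat_matpow: "complex_mat (matpow A k) = matpow (complex_mat A) k"
  by (induction k) (simp_all add: complex_mat_mult)

lemma norm_complex_vec [simp]: "norm (complex_vec v) = norm v"
  by (simp add: norm_vec_def)

section \<open>Complex conjugation and real spectral projections\<close>

definition cnj_vec :: "complex ^ 'n \<Rightarrow> complex ^ 'n" where
  "cnj_vec v = (\<chi> i. cnj (v $ i))"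

lemma cnj_vec_simps:
  "cnj_vec (u + v) = cnj_vec u + cnj_vec v" "cnj_vec 0 = 0"
  "cnj_vec (c *s v) = cnj c *s cnj_vec v" "cnj_vec (cnj_vec v) = v"
  "cnj_vec (complex_vec x) = complex_vec x"
  "cnj_vec (complex_mat A *v v) = complex_mat A *v cnj_vec v"
  by (simp_all add: cnj_vec_def vec_eq_iff matrix_vector_mult_def)

lemma cnj_vec_sum: "cnj_vec (\<Sum>i\<in>I. f i) = (\<Sum>i\<in>I. cnj_vec (f i))"
  by (induction I rule: infinite_finite_induct) (simp_all add: cnj_vec_simps)

lemma cnj_vec_eq_0: "cnj_vec v = 0 \<longleftrightarrow> v = 0"
  by (simp add: cnj_vec_def vec_eq_iff)

lemma cnj_eigenvals: "z \<in> eigenvals (complex_mat \<Phi>) \<Longrightarrow> cnj z \<in> eigenvals (complex_mat \<Phi>)"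
  unfolding eigenvals_def mem_Collect_eq using cnj_vec_eq_0 cnj_vec_simps(3,6) by metis

lemma bij_betw_cnj:
  assumes "\<And>z. z \<in> A \<Longrightarrow> cnj z \<in> A"
  shows "bij_betw cnj A A"
  using assms by (intro bij_betw_byWitness[of _ cnj]) auto

lemma cnj_gen_eigenspace:
  fixes \<Phi> :: "real ^ 'n ^ 'n"
  assumes "v \<in> gen_eigenspace (complex_mat \<Phi>) z"
  shows "cnj_vec v \<in> gen_eigenspace (complex_mat \<Phi>) (cnj z)"
proof -
  have "matpow (complex_mat \<Phi> - mat (cnj z)) k *v cnj_vec v =
      cnj_vec (matpow (complex_mat \<Phi> - mat z) k *v v)" for k
  proof (induction k)
    case (Suc k)
    have "cnj_vec ((complex_mat \<Phi> - mat z) *v w) = (complex_mat \<Phi> - mat (cnj z)) *v cnj_vec w" for w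
      by (simp add: matrix_vector_mult_diff_rdistrib mat_vec_mult cnj_vec_simps flip: cnj_vec_simps(3,6))
        (simp add: cnj_vec_def vec_eq_iff)
    then show ?case by (simp add: matpow_mult_vec_Suc Suc del: matpow.simps)
  qed simp
  then show ?thesis using assms by (simp add: gen_eigenspace_def cnj_vec_simps)
qed

lemma gen_part_cnj:
  assumes "z \<in> eigenvals (complex_mat \<Phi>)"
  shows "gen_part (complex_mat \<Phi>) (cnj_vec v) z = cnj_vec (gen_part (complex_mat \<Phi>) v (cnj z))"
proof -
  let ?M = "complex_mat \<Phi>"
  have "(\<Sum>z\<in>eigenvals ?M. gen_part ?M v (cnj z)) = v"
    using sum.reindex_bij_betw[OF bij_betw_cnj[OF cnj_eigenvals], of \<Phi> "gen_part ?M v"]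
      gen_part_sum[of ?M v] by simp
  then have "cnj_vec v = (\<Sum>z\<in>eigenvals ?M. cnj_vec (gen_part ?M v (cnj z)))"
    by (simp flip: cnj_vec_sum)
  moreover have "cnj_vec (gen_part ?M v (cnj z)) \<in> gen_eigenspace ?M z" if "z \<in> eigenvals ?M" for z
    using cnj_gen_eigenspace[OF gen_part_mem[OF cnj_eigenvals[OF that]], of v] by simp
  ultimately show ?thesis using assms by (intro gen_part_eqI)
qed

text \<open>Conjugation exchanges the components for \<open>z\<close> and \<open>cnj z\<close>. As
  \<open>A\<close> is closed under conjugation, the projection commutes with conjugation, so its
  columns, the images of the real unit vectors, are real.\<close>

lemma complex_mat_real_spectral_proj:
  fixes \<Phi> :: "real ^ 'n ^ 'n"
  assumes A: "A \<subseteq> eigenvals (complex_mat \<Phi>)" and cnj: "\<And>z. z \<in> A \<Longrightarrow> cnj z \<in> A"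
  shows "complex_mat (real_spectral_proj \<Phi> A) = spectral_proj (complex_mat \<Phi>) A"
proof -
  let ?M = "complex_mat \<Phi>"
  define P where "P = spectral_proj ?M A"
  have "P *v cnj_vec v = cnj_vec (P *v v)" for v
  proof -
    have "P *v cnj_vec v = (\<Sum>z\<in>A. cnj_vec (gen_part ?M v (cnj z)))"
      using A by (auto simp: P_def spectral_proj_vec gen_part_cnj intro!: sum.cong)
    also have "\<dots> = (\<Sum>z\<in>A. cnj_vec (gen_part ?M v z))"
      by (rule sum.reindex_bij_betw[OF bij_betw_cnj[OF cnj]])
    finally show ?thesis using A by (simp add: P_def spectral_proj_vec cnj_vec_sum)
  qed
  from this[of "axis j 1" for j] have "cnj (P $ i $ j) = P $ i $ j" for i j
  proof -
    have *: "P *v axis j 1 = column j P"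
      by (simp add: matrix_vector_mult_def axis_def column_def vec_eq_iff if_distrib[of "\<lambda>x. _ * x"]
          cong: if_cong)
    have "cnj_vec (axis j 1) = axis j (1::complex)"
      by (simp add: cnj_vec_def axis_def vec_eq_iff)
    then have "column j P = cnj_vec (column j P)"
      using \<open>P *v cnj_vec (axis j 1) = cnj_vec (P *v axis j 1)\<close> by (simp add: *)
    then show ?thesis by (simp add: vec_eq_iff column_def cnj_vec_def)
  qed
  then have "complex_of_real (Re (P $ i $ j)) = P $ i $ j" for i j
    by (metis Reals_cnj_iff of_real_Re)
  then have "complex_mat (\<chi> i j. Re (P $ i $ j)) = P"
    by (simp add: vec_eq_iff)
  then show ?thesis
    unfolding real_spectral_proj_def P_def[symmetric]
    by (intro theI[of "\<lambda>Q. complex_mat Q = P"]) (auto simp flip: complex_mat_inject)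
qed

subsection \<open>Projections selected by the modulus of the eigenvalues\<close>

text \<open>One family covers all four projections: a condition on the modulus selects a set closed
  under conjugation, products become conjunctions, and sums of disjoint conditions become
  disjunctions.\<close>

definition mod_proj :: "real ^ 'n ^ 'n \<Rightarrow> (real \<Rightarrow> bool) \<Rightarrow> real ^ 'n ^ 'n" where
  "mod_proj \<Phi> Q = real_spectral_proj \<Phi> {z \<in> eigenvals (complex_mat \<Phi>). Q (cmod z)}"

lemma complex_mod_proj:
  "complex_mat (mod_proj \<Phi> Q) =
    spectral_proj (complex_mat \<Phi>) {z \<in> eigenvals (complex_mat \<Phi>). Q (cmod z)}"
  unfolding mod_proj_def
  by (rule complex_mat_real_spectral_proj) (auto intro: cnj_eigenvals)

lemma mod_proj_mult: "mod_proj \<Phi> Q ** mod_proj \<Phi> R = mod_proj \<Phi> (\<lambda>r. Q r \<and> R r)"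
proof -
  have "{z \<in> eigenvals (complex_mat \<Phi>). Q (cmod z)} \<inter> {z \<in> eigenvals (complex_mat \<Phi>). R (cmod z)} =
      {z \<in> eigenvals (complex_mat \<Phi>). Q (cmod z) \<and> R (cmod z)}" by blast
  then show ?thesis
    by (simp flip: complex_mat_inject add: complex_mod_proj complex_mat_mult spectral_proj_mult)
qed

lemma mod_proj_mult_vec:
  "mod_proj \<Phi> Q *v (mod_proj \<Phi> R *v v) = mod_proj \<Phi> (\<lambda>r. Q r \<and> R r) *v v"
  by (simp add: matrix_vector_mul_assoc mod_proj_mult)

lemma mod_proj_add:
  assumes "\<And>r. \<not> (Q r \<and> R r)"
  shows "mod_proj \<Phi> (\<lambda>r. Q r \<or> R r) = mod_proj \<Phi> Q + mod_proj \<Phi> R"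
proof -
  have "{z \<in> eigenvals (complex_mat \<Phi>). Q (cmod z) \<or> R (cmod z)} =
      {z \<in> eigenvals (complex_mat \<Phi>). Q (cmod z)} \<union> {z \<in> eigenvals (complex_mat \<Phi>). R (cmod z)}"
    by blast
  moreover have "{z \<in> eigenvals (complex_mat \<Phi>). Q (cmod z)} \<inter>
      {z \<in> eigenvals (complex_mat \<Phi>). R (cmod z)} = {}" using assms by blast
  ultimately show ?thesis
    by (simp flip: complex_mat_inject add: complex_mod_proj spectral_proj_Un)
qed

text \<open>Conditions are compared for nonnegative \<open>r\<close> only, so that for instance
  \<open>r \<noteq> 0\<close> and \<open>0 < r\<close> select the same eigenvalues.\<close>

lemma mod_proj_cong:
  "(\<And>r. r \<ge> 0 \<Longrightarrow> Q r = R r) \<Longrightarrow> mod_proj \<Phi> Q = mod_proj \<Phi> R"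
  by (simp add: mod_proj_def)

lemma mod_proj_True: "mod_proj \<Phi> (\<lambda>_. True) = mat 1"
  by (simp flip: complex_mat_inject add: complex_mod_proj spectral_proj_eigenvals)

lemma mod_proj_commute: "mod_proj \<Phi> Q ** \<Phi> = \<Phi> ** mod_proj \<Phi> Q"
  by (simp flip: complex_mat_inject add: complex_mod_proj complex_mat_mult spectral_proj_commute)

lemma mod_proj_commute_vec: "mod_proj \<Phi> Q *v (\<Phi> *v v) = \<Phi> *v (mod_proj \<Phi> Q *v v)"
  by (simp add: matrix_vector_mul_assoc mod_proj_commute)

lemma mod_proj_zero_nilpotent:
  fixes \<Phi> :: "real ^ 'n ^ 'n"
  shows "matpow \<Phi> CARD('n) ** mod_proj \<Phi> (\<lambda>r. r = 0) = 0"
proof (cases "0 \<in> eigenvals (complex_mat \<Phi>)")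
  case True
  then have "{z \<in> eigenvals (complex_mat \<Phi>). cmod z = 0} = {0}" by auto
  moreover have "complex_mat \<Phi> - mat 0 = complex_mat \<Phi>" by (simp add: mat_def vec_eq_iff)
  ultimately show ?thesis
    using spectral_proj_nilpotent(2)[OF True]
    by (simp flip: complex_mat_inject add: complex_mod_proj complex_mat_mult complex_mat_matpow)
next
  case False
  then have "{z \<in> eigenvals (complex_mat \<Phi>). cmod z = 0} = {}" by auto
  then have "mod_proj \<Phi> (\<lambda>r. r = 0) = 0"
    by (simp only: complex_mod_proj spectral_proj_empty complex_mat_simps flip: complex_mat_inject)
  then show ?thesis by simp
qed

lemma mod_proj_nonzero: "mod_proj \<Phi> (\<lambda>r. r \<noteq> 0) = mat 1 - mod_proj \<Phi> (\<lambda>r. r = 0)"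
  using mod_proj_add[of "\<lambda>r. r = 0" "\<lambda>r. r \<noteq> 0" \<Phi>] mod_proj_True[of \<Phi>] by simp

lemma mod_proj_nonzero_matpow:
  fixes \<Phi> :: "real ^ 'n ^ 'n"
  shows "matpow \<Phi> CARD('n) ** mod_proj \<Phi> (\<lambda>r. r \<noteq> 0) = matpow \<Phi> CARD('n)"
  by (simp add: mod_proj_nonzero matrix_diff_ldistrib mod_proj_zero_nilpotent)

subsection \<open>The Drazin inverse\<close>

lemma matrix_add_rdistrib: "(A + B) ** C = A ** C + B ** C"
  for A :: "'a::semiring_1 ^ 'n ^ 'm"
  by (simp add: matrix_matrix_mult_def vec_eq_iff distrib_right sum.distrib)

text \<open>\<open>D ** A\<close> is idempotent and its factors commute, so all its positive powers
  coincide.\<close>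

lemma commuting_inverse_power:
  fixes A D :: "'a::semiring_1 ^ 'n ^ 'n"
  assumes D: "D ** A ** D = D" "D ** A = A ** D"
  shows "matpow D (Suc j) ** matpow A (Suc j) = D ** A"
proof (induction j)
  case (Suc j)
  have "matpow D (Suc (Suc j)) ** matpow A (Suc (Suc j)) =
      D ** (matpow D (Suc j) ** matpow A (Suc j)) ** A"
    by (subst matpow_Suc_right[of A "Suc j"], subst matpow.simps(2)[of D "Suc j"])
      (simp only: matrix_mul_assoc)
  also have "\<dots> = D ** (A ** D) ** A" by (simp only: Suc D(2))
  also have "\<dots> = D ** A" by (simp only: matrix_mul_assoc D(1))
  finally show ?case .
qed simp

text \<open>The idempotents \<open>D ** A\<close> and \<open>D' ** A\<close> absorb each other and
  are therefore equal; then \<open>D = D A D = D' A D = D' A D' = D'\<close>.\<close>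

lemma drazin_unique:
  fixes A D D' :: "'a::semiring_1 ^ 'n ^ 'n"
  assumes D: "D ** A ** D = D" "D ** A = A ** D" "D ** matpow A (k + 1) = matpow A k"
    and D': "D' ** A ** D' = D'" "D' ** A = A ** D'" "D' ** matpow A (k + 1) = matpow A k"
  shows "D = D'"
proof -
  \<comment> \<open>Expand \<open>D ** A\<close> into powers of order \<open>k + 1\<close>; there
    the third equation for \<open>D'\<close> removes the factor \<open>D'\<close>. Stated for
    arbitrary matrices so that the roles can be exchanged.\<close>
  have *: "(A ** D') ** (D ** A) = D ** A" "(D ** A) ** (A ** D') = D ** A"
    if D: "D ** A ** D = D" "D ** A = A ** D"
      and D': "D' ** A = A ** D'" "D' ** matpow A (k + 1) = matpow A k"
    for D D' :: "'a ^ 'n ^ 'n"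
  proof -
    have p1: "matpow D (Suc k) ** matpow A (Suc k) = D ** A"
      by (rule commuting_inverse_power[OF D])
    have "A ** matpow D (Suc k) = matpow D (Suc k) ** A"
      by (rule matpow_commute[OF D(2), symmetric])
    from matpow_commute[OF this, of "Suc k"]
    have p2: "matpow A (Suc k) ** matpow D (Suc k) = D ** A" using p1 by simp
    have "(A ** D') ** (D ** A) = A ** (D' ** matpow A (k + 1)) ** matpow D (Suc k)"
      unfolding p2[symmetric] by (simp only: matrix_mul_assoc Suc_eq_plus1)
    also have "\<dots> = D ** A" by (simp only: D'(2) p2 flip: matpow.simps(2))
    finally show "(A ** D') ** (D ** A) = D ** A" .
    have c: "D' ** matpow A (k + 1) = matpow A (k + 1) ** D'"
      using matpow_commute[OF D'(1)[symmetric], of "k + 1"] by simp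
    have "(D ** A) ** (A ** D') = matpow D (Suc k) ** (matpow A (k + 1) ** D') ** A"
      unfolding p1[symmetric] by (simp only: matrix_mul_assoc Suc_eq_plus1 flip: D'(1))
    also have "\<dots> = matpow D (Suc k) ** (matpow A k ** A)"
      by (simp only: c[symmetric] D'(2) matrix_mul_assoc)
    also have "\<dots> = D ** A" by (simp only: p1 flip: matpow_Suc_right)
    finally show "(D ** A) ** (A ** D') = D ** A" .
  qed
  have X: "D ** A = D' ** A"
    using *(2)[OF D(1,2) D'(2,3)] *(1)[OF D'(1,2) D(2,3)] by (simp only: D(2) D'(2))
  have "D = D' ** (A ** D)" using D(1) X by (simp only: matrix_mul_assoc)
  also have "\<dots> = D' ** (A ** D')" using X by (simp only: D(2) D'(2))
  also have "\<dots> = D'" using D'(1) by (simp only: matrix_mul_assoc)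
  finally show ?thesis .
qed

text \<open>The Drazin inverse is constructed as \<open>L ** Q\<close>, where \<open>Q\<close>
  projects along the generalized kernel and \<open>L\<close> inverts a modification of
  \<open>\<Phi>\<close>; \<open>drazin_unique\<close> then identifies it.\<close>

lemma drazin_spec:
  fixes \<Phi> :: "real ^ 'n ^ 'n"
  shows "drazin \<Phi> ** \<Phi> = mod_proj \<Phi> (\<lambda>r. r \<noteq> 0)"
    and "\<Phi> ** drazin \<Phi> = mod_proj \<Phi> (\<lambda>r. r \<noteq> 0)"
    and "drazin \<Phi> ** mod_proj \<Phi> (\<lambda>r. r \<noteq> 0) = drazin \<Phi>"
proof -
  define Q where "Q = mod_proj \<Phi> (\<lambda>r. r \<noteq> 0)"
  have QQ: "Q ** Q = Q" by (simp add: Q_def mod_proj_mult)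
  have Q\<Phi>: "Q ** \<Phi> = \<Phi> ** Q" by (simp add: Q_def mod_proj_commute)
  \<comment> \<open>\<open>K\<close> acts as \<open>\<Phi>\<close> on the range of \<open>Q\<close>
    and as the identity on the generalized kernel. If \<open>K v = 0\<close>, applying
    \<open>Q\<close> gives \<open>\<Phi> Q v = 0\<close>, hence \<open>v = Q v\<close> is a kernel
    vector of \<open>\<Phi>\<close> without component at 0, and it vanishes.\<close>
  define K where "K = \<Phi> ** Q + (mat 1 - Q)"
  have KQ: "K ** Q = \<Phi> ** Q"
    by (simp add: K_def matrix_add_rdistrib matrix_diff_rdistrib QQ flip: matrix_mul_assoc)
  have QK: "Q ** K = \<Phi> ** Q"
    by (simp add: K_def matrix_add_ldistrib matrix_diff_ldistrib QQ matrix_mul_assoc Q\<Phi>)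
      (simp add: QQ flip: matrix_mul_assoc)
  have "v = 0" if "K *v v = 0" for v
  proof -
    have 1: "\<Phi> *v (Q *v v) = 0"
      using that QK by (metis matrix_vector_mul_assoc matrix_vector_mult_0_right)
    moreover have "K *v v = \<Phi> *v (Q *v v) + (v - Q *v v)"
      by (simp add: K_def matrix_vector_mult_add_rdistrib matrix_vector_mult_diff_rdistrib
          matrix_vector_mul_assoc)
    ultimately have Qv: "Q *v v = v" using that by simp
    have "complex_mat Q *v complex_vec v = complex_vec v"
      by (simp add: Qv flip: complex_mat_vec)
    moreover have "{z \<in> eigenvals (complex_mat \<Phi>). cmod z \<noteq> 0} = eigenvals (complex_mat \<Phi>) - {0}"
      by auto
    ultimately have sp: "spectral_proj (complex_mat \<Phi>) (eigenvals (complex_mat \<Phi>) - {0}) *v complex_vec v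
        = complex_vec v"
      by (simp only: Q_def complex_mod_proj)
    have "complex_mat \<Phi> *v complex_vec v = 0"
      using 1 Qv by (simp flip: complex_mat_vec)
    from spectral_proj_nonzero_kernel[OF this sp] have "complex_vec v = 0" .
    then show ?thesis by (simp flip: complex_vec_simps(1))
  qed
  then obtain L where LK: "L ** K = mat 1" using matrix_left_invertible_ker[of K] by blast
  then have KL: "K ** L = mat 1" by (simp add: matrix_left_right_inverse)
  have inv_commute: "L ** B = B ** L" if "K ** B = B ** K" for B
  proof -
    have "L ** B = L ** (B ** K) ** L" by (simp add: KL flip: matrix_mul_assoc)
    also have "\<dots> = B ** L" by (simp add: that[symmetric] matrix_mul_assoc LK)
    finally show ?thesis .
  qed
  have K\<Phi>: "K ** \<Phi> = \<Phi> ** K"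
    by (simp add: K_def matrix_add_rdistrib matrix_add_ldistrib matrix_diff_rdistrib
        matrix_diff_ldistrib Q\<Phi> flip: matrix_mul_assoc)
  have LQ: "L ** Q = Q ** L" and L\<Phi>: "L ** \<Phi> = \<Phi> ** L"
    using inv_commute KQ QK K\<Phi> by simp_all
  define D where "D = L ** Q"
  have D\<Phi>: "D ** \<Phi> = Q"
  proof -
    have "D ** \<Phi> = L ** (K ** Q)" by (simp add: D_def KQ Q\<Phi> flip: matrix_mul_assoc)
    then show ?thesis by (simp add: matrix_mul_assoc LK)
  qed
  have \<Phi>D: "\<Phi> ** D = Q"
    using D\<Phi> by (simp add: D_def matrix_mul_assoc flip: L\<Phi>) (simp add: Q\<Phi> flip: matrix_mul_assoc)
  have DQ: "D ** Q = D" by (simp add: D_def QQ flip: matrix_mul_assoc)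
  have QD: "Q ** D = D" by (simp add: D_def matrix_mul_assoc flip: LQ) (simp add: QQ flip: matrix_mul_assoc)
  have "Q ** matpow \<Phi> CARD('n) = matpow \<Phi> CARD('n)"
    using mod_proj_nonzero_matpow[of \<Phi>] matpow_commute[of \<Phi> Q] Q\<Phi> by (simp add: Q_def)
  then have D3: "D ** matpow \<Phi> (CARD('n) + 1) = matpow \<Phi> CARD('n)"
    by (simp add: matrix_mul_assoc D\<Phi>)
  have "drazin \<Phi> = D"
    unfolding drazin_def
  proof (rule the_equality)
    show "D ** \<Phi> ** D = D \<and> D ** \<Phi> = \<Phi> ** D \<and> D ** matpow \<Phi> (CARD('n) + 1) = matpow \<Phi> CARD('n)"
      using D3 by (simp add: D\<Phi> \<Phi>D QD)
    then show "D' = D" if "D' ** \<Phi> ** D' = D' \<and> D' ** \<Phi> = \<Phi> ** D' \<and>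
        D' ** matpow \<Phi> (CARD('n) + 1) = matpow \<Phi> CARD('n)" for D'
      using that by (intro drazin_unique[of D' \<Phi> "CARD('n)" D]) blast+
  qed
  then show "drazin \<Phi> ** \<Phi> = mod_proj \<Phi> (\<lambda>r. r \<noteq> 0)"
    and "\<Phi> ** drazin \<Phi> = mod_proj \<Phi> (\<lambda>r. r \<noteq> 0)"
    and "drazin \<Phi> ** mod_proj \<Phi> (\<lambda>r. r \<noteq> 0) = drazin \<Phi>"
    using D\<Phi> \<Phi>D DQ by (simp_all add: Q_def)
qed

subsection \<open>Exponential decay\<close>

text \<open>\<open>b / (1 - c)\<close> is the fixed point of the affine map, and every bound at or
  above it is preserved by the recurrence.\<close>

lemma bounded_affine_recurrence:
  fixes u :: "nat \<Rightarrow> real"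
  assumes c: "0 \<le> c" "c < 1" and u: "\<And>k. u (Suc k) \<le> c * u k + b"
  shows "u k \<le> max (u 0) (b / (1 - c))"
proof (induction k)
  case (Suc k)
  define K where "K = max (u 0) (b / (1 - c))"
  have "b / (1 - c) \<le> K" by (simp add: K_def)
  then have "b \<le> K * (1 - c)" using c by (simp add: pos_divide_le_eq)
  moreover have "u (Suc k) \<le> c * K + b"
    using u[of k] mult_left_mono[OF Suc c(1)] unfolding K_def by linarith
  ultimately show ?case unfolding K_def[symmetric] by (simp add: algebra_simps)
qed simp

lemma norm_complex_scale: "norm (c *s v) = cmod c * norm v"
  for v :: "complex ^ 'n"
  by (simp add: norm_vec_def norm_mult L2_set_right_distrib)

text \<open>Induction along the chain: with \<open>v' = (A - w) v\<close>, the norm of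
  \<open>A^(k+1) v\<close> is at most \<open>|w|\<close> times that of \<open>A^k v\<close> plus
  that of \<open>A^k v'\<close>. Division by powers of \<rho> gives an affine recurrence with factor
  \<open>|w| / \<rho> < 1\<close>; the gap between \<open>|w|\<close> and \<rho> absorbs the
  polynomial growth.\<close>

lemma matpow_gen_eigenvector_bound:
  fixes A :: "complex ^ 'n ^ 'n"
  assumes "matpow (A - mat w) j *v v = 0" "cmod w < \<rho>"
  shows "\<exists>K. \<forall>k. norm (matpow A k *v v) \<le> K * \<rho> ^ k"
  using assms(1)
proof (induction j arbitrary: v)
  case 0
  then show ?case by (intro exI[of _ 0]) simp
next
  case (Suc j)
  have \<rho>: "0 < \<rho>" using assms(2) norm_ge_zero[of w] by linarith
  define v' where "v' = (A - mat w) *v v"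
  have "matpow (A - mat w) j *v v' = 0"
    using Suc.prems matpow_Suc_right[of "A - mat w" j] by (simp add: v'_def matrix_vector_mul_assoc)
  from Suc.IH[OF this] obtain K where K: "\<And>k. norm (matpow A k *v v') \<le> K * \<rho> ^ k" by blast
  define u where "u k = norm (matpow A k *v v) / \<rho> ^ k" for k
  have "u (Suc k) \<le> (cmod w / \<rho>) * u k + K / \<rho>" for k
  proof -
    have "A *v v = w *s v + v'" by (simp add: v'_def matrix_vector_mult_diff_rdistrib mat_vec_mult)
    then have "matpow A (Suc k) *v v = w *s (matpow A k *v v) + matpow A k *v v'"
      unfolding matpow_Suc_right
      by (simp add: matrix_vector_right_distrib vector_scalar_commute flip: matrix_vector_mul_assoc)
    then have "norm (matpow A (Suc k) *v v) \<le> cmod w * norm (matpow A k *v v) + K * \<rho> ^ k"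
      using norm_triangle_ineq[of "w *s (matpow A k *v v)" "matpow A k *v v'"] K[of k]
      by (simp add: norm_complex_scale)
    then show ?thesis using \<rho> by (simp add: u_def field_simps)
  qed
  from bounded_affine_recurrence[of "cmod w / \<rho>" u "K / \<rho>", OF _ _ this] have "u k \<le> max (u 0) ((K / \<rho>) / (1 - cmod w / \<rho>))" for k
    using \<rho> assms(2) by simp
  then show ?case using \<rho> by (auto simp: u_def pos_divide_le_eq)
qed

text \<open>The label \<open>z\<close> of a component is separated from the eigenvalue
  \<open>g z\<close> of \<open>A\<close> on it, so that the lemma serves \<open>\<Phi>\<close> with
  \<open>g z = z\<close> as well as its Drazin inverse with \<open>g z = 1 / z\<close>.\<close>

lemma exponential_decay:
  fixes A P :: "real ^ 'n ^ 'n"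
  assumes "\<And>v. complex_mat P *v v = (\<Sum>z\<in>S. f v z)"
    and nil: "\<And>v z. z \<in> S \<Longrightarrow> matpow (complex_mat A - mat (g z)) (m z) *v f v z = 0"
    and \<rho>: "\<And>z. z \<in> S \<Longrightarrow> cmod (g z) < \<rho>" "finite S"
  shows "\<exists>C. \<forall>k v. norm (matpow A k *v (P *v v)) \<le> C * \<rho> ^ k * norm v"
proof -
  have "\<exists>K. \<forall>k. norm (matpow A k *v (P *v v)) \<le> K * \<rho> ^ k" for v
  proof -
    have "\<forall>z\<in>S. \<exists>K. \<forall>k. norm (matpow (complex_mat A) k *v f (complex_vec v) z) \<le> K * \<rho> ^ k"
      using matpow_gen_eigenvector_bound[OF nil \<rho>(1)] by blast
    then obtain K where K: "\<And>z k. z \<in> S \<Longrightarrow>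
        norm (matpow (complex_mat A) k *v f (complex_vec v) z) \<le> K z * \<rho> ^ k"
      by (auto simp: bchoice_iff)
    have "norm (matpow A k *v (P *v v)) \<le> (\<Sum>z\<in>S. K z) * \<rho> ^ k" for k
    proof -
      have "norm (matpow A k *v (P *v v)) = norm (complex_vec (matpow A k *v (P *v v)))" by simp
      also have "\<dots> = norm (\<Sum>z\<in>S. matpow (complex_mat A) k *v f (complex_vec v) z)"
        by (simp only: complex_mat_vec complex_mat_matpow assms(1) matrix_vector_mult_sum)
      also have "\<dots> \<le> (\<Sum>z\<in>S. K z * \<rho> ^ k)" by (intro sum_norm_le K)
      finally show ?thesis by (simp add: sum_distrib_right)
    qed
    then show ?thesis by blast
  qed
  then obtain K where K: "\<And>v k. norm (matpow A k *v (P *v v)) \<le> K v * \<rho> ^ k" by metis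
  \<comment> \<open>Expanding \<open>v\<close> in unit vectors replaces the constant depending on
    \<open>v\<close> by a uniform one.\<close>
  have "norm (matpow A k *v (P *v v)) \<le> (\<Sum>i\<in>UNIV. K (axis i 1)) * \<rho> ^ k * norm v" for k v
  proof -
    have "matpow A k *v (P *v v) = matpow A k *v (P *v (\<Sum>i\<in>UNIV. v $ i *s axis i 1))"
      by (simp only: basis_expansion)
    also have "\<dots> = (\<Sum>i\<in>UNIV. v $ i *s (matpow A k *v (P *v axis i 1)))"
      by (simp add: matrix_vector_mult_sum vector_scalar_commute)
    also have "norm \<dots> \<le> (\<Sum>i\<in>UNIV. norm v * (K (axis i 1) * \<rho> ^ k))"
    proof (rule sum_norm_le)
      fix i
      show "norm (v $ i *s (matpow A k *v (P *v axis i 1))) \<le> norm v * (K (axis i 1) * \<rho> ^ k)"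
        using K[of k "axis i 1"] component_le_norm_cart[of v i]
        by (simp add: scalar_mult_eq_scaleR mult_mono)
    qed
    finally show ?thesis by (simp add: sum_distrib_left sum_distrib_right mult_ac)
  qed
  then show ?thesis by blast
qed

lemma finite_less_one_bound:
  assumes "finite S" "\<And>z. z \<in> S \<Longrightarrow> f z < (1::real)"
  shows "\<exists>\<rho>. 0 < \<rho> \<and> \<rho> < 1 \<and> (\<forall>z\<in>S. f z < \<rho>)"
proof -
  \<comment> \<open>Inserting 0 covers an empty \<open>S\<close> and makes the midpoint
    \<open>(m + 1) / 2\<close> positive.\<close>
  define m where "m = Max (insert 0 (f ` S))"
  have "m \<in> insert 0 (f ` S)" unfolding m_def using assms(1) by (intro Max_in) auto
  then have "m < 1" using assms(2) by auto
  moreover have "f z \<le> m" if "z \<in> S" for z unfolding m_def using assms(1) that by (intro Max_ge) auto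
  moreover have "0 \<le> m" unfolding m_def using assms(1) by (intro Max_ge) auto
  ultimately show ?thesis by (intro exI[of _ "(m + 1) / 2"]) fastforce
qed

lemma lt1_decay:
  "\<exists>C \<rho>. 0 < \<rho> \<and> \<rho> < 1 \<and>
    (\<forall>k v. norm (matpow \<Phi> k *v (mod_proj \<Phi> (\<lambda>r. r < 1) *v v)) \<le> C * \<rho> ^ k * norm v)"
proof -
  let ?S = "{z \<in> eigenvals (complex_mat \<Phi>). cmod z < 1}"
  have S: "finite ?S" using finite_eigenvals[of "complex_mat \<Phi>"] by simp
  obtain \<rho> where \<rho>: "0 < \<rho>" "\<rho> < 1" "\<forall>z\<in>?S. cmod z < \<rho>"
    using finite_less_one_bound[OF S, of cmod] by blast
  have "\<exists>C. \<forall>k v. norm (matpow \<Phi> k *v (mod_proj \<Phi> (\<lambda>r. r < 1) *v v)) \<le> C * \<rho> ^ k * norm v"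
  proof (rule exponential_decay)
    show "complex_mat (mod_proj \<Phi> (\<lambda>r. r < 1)) *v v = (\<Sum>z\<in>?S. gen_part (complex_mat \<Phi>) v z)" for v
      by (simp add: complex_mod_proj spectral_proj_vec)
    show "matpow (complex_mat \<Phi> - mat z) CARD('a) *v gen_part (complex_mat \<Phi>) v z = 0"
      if "z \<in> ?S" for v z
      using gen_part_mem[of z "complex_mat \<Phi>" v] that by (simp add: gen_eigenspace_def)
  qed (use \<rho> S in auto)
  then show ?thesis using \<rho> by blast
qed

text \<open>On the range of the projection, \<open>D - 1/z\<close> equals
  \<open>-(1/z) D (M - z)\<close>. Since \<open>D\<close> commutes with \<open>M - z\<close>, each
  such factor shortens the chain of \<open>u\<close> by one.\<close>

lemma drazin_gen_eigenvector:
  assumes "z \<noteq> 0" "matpow (complex_mat \<Phi> - mat z) j *v u = 0"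
    "complex_mat (mod_proj \<Phi> (\<lambda>r. r \<noteq> 0)) *v u = u"
  shows "matpow (complex_mat (drazin \<Phi>) - mat (1 / z)) j *v u = 0"
  using assms(2,3)
proof (induction j arbitrary: u)
  case (Suc j)
  let ?M = "complex_mat \<Phi>" and ?D = "complex_mat (drazin \<Phi>)"
    and ?Q = "complex_mat (mod_proj \<Phi> (\<lambda>r. r \<noteq> 0))"
  have DM: "?D ** ?M = ?Q" and MD: "?M ** ?D = ?Q" and DQ: "?D ** ?Q = ?D"
    using drazin_spec[of \<Phi>] by (simp_all flip: complex_mat_mult)
  have QD: "?Q ** ?D = ?D" using DM MD DQ by (metis matrix_mul_assoc)
  define u' where "u' = (?D - mat (1 / z)) *v u"
  have u': "u' = (- 1 / z) *s (?D *v ((?M - mat z) *v u))"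
  proof -
    have "?D *v ((?M - mat z) *v u) = u - z *s (?D *v u)"
      using Suc.prems(2)
      by (simp add: matrix_vector_mult_diff_rdistrib matrix_vector_mult_diff_distrib mat_vec_mult
          vector_scalar_commute matrix_vector_mul_assoc DM)
    then show ?thesis
      using assms(1) by (simp add: u'_def matrix_vector_mult_diff_rdistrib mat_vec_mult
          vector_ssub_ldistrib vector_smult_assoc)
  qed
  have comm: "matpow (?M - mat z) j ** ?D = ?D ** matpow (?M - mat z) j"
    using DM MD by (intro matpow_diff_mat_commute) simp
  have "matpow (?M - mat z) j *v (?D *v ((?M - mat z) *v u)) = ?D *v (matpow (?M - mat z) (Suc j) *v u)"
    unfolding matpow_Suc_right by (simp add: matrix_vector_mul_assoc matrix_mul_assoc comm)
  then have 1: "matpow (?M - mat z) j *v u' = 0"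
    using Suc.prems(1)
    by (simp only: u' vector_scalar_commute matrix_vector_mult_0_right vec.scale_zero_right)
  have 2: "?Q *v u' = u'"
    by (simp only: u' vector_scalar_commute matrix_vector_mul_assoc matrix_mul_assoc QD)
  have "matpow (?D - mat (1 / z)) (Suc j) *v u = matpow (?D - mat (1 / z)) j *v u'"
    unfolding matpow_Suc_right by (simp add: u'_def matrix_vector_mul_assoc)
  then show ?case using Suc.IH[OF 1 2] by simp
qed simp

lemma left_decay:
  "\<exists>C \<rho>. 0 < \<rho> \<and> \<rho> < 1 \<and>
    (\<forall>k v. norm (matpow (drazin \<Phi>) k *v (mod_proj \<Phi> (\<lambda>r. r > 1) *v v)) \<le> C * \<rho> ^ k * norm v)"
proof -
  let ?M = "complex_mat \<Phi>"
  let ?S = "{z \<in> eigenvals ?M. cmod z > 1}"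
  have S: "finite ?S" using finite_eigenvals[of "complex_mat \<Phi>"] by simp
  have "\<exists>\<rho>. 0 < \<rho> \<and> \<rho> < 1 \<and> (\<forall>z\<in>?S. cmod (1 / z) < \<rho>)"
    by (rule finite_less_one_bound[OF S]) (auto simp: norm_divide divide_less_eq)
  then obtain \<rho> where \<rho>: "0 < \<rho>" "\<rho> < 1" "\<forall>z\<in>?S. cmod (1 / z) < \<rho>" by blast
  have "\<exists>C. \<forall>k v. norm (matpow (drazin \<Phi>) k *v (mod_proj \<Phi> (\<lambda>r. r > 1) *v v)) \<le> C * \<rho> ^ k * norm v"
  proof (rule exponential_decay)
    show "complex_mat (mod_proj \<Phi> (\<lambda>r. r > 1)) *v v = (\<Sum>z\<in>?S. gen_part ?M v z)" for v
      by (simp add: complex_mod_proj spectral_proj_vec)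
    show "matpow (complex_mat (drazin \<Phi>) - mat (1 / z)) CARD('a) *v gen_part ?M v z = 0"
      if "z \<in> ?S" for v z
    proof (rule drazin_gen_eigenvector)
      show "z \<noteq> 0" using that by auto
      show "matpow (?M - mat z) CARD('a) *v gen_part ?M v z = 0"
        using gen_part_mem[of z ?M v] that by (simp add: gen_eigenspace_def)
      let ?A = "{z \<in> eigenvals ?M. cmod z \<noteq> 0}"
      have "?A \<inter> {z} = {z}" using that by auto
      then have "spectral_proj ?M ?A ** spectral_proj ?M {z} = spectral_proj ?M {z}"
        using that spectral_proj_mult[of ?A ?M "{z}"] by simp
      then show "complex_mat (mod_proj \<Phi> (\<lambda>r. r \<noteq> 0)) *v gen_part ?M v z = gen_part ?M v z"
        using that unfolding complex_mod_proj
        by (simp add: matrix_vector_mul_assoc flip: spectral_proj_singleton_vec)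
    qed
  qed (use \<rho> S in auto)
  then show ?thesis using \<rho> by blast
qed

section \<open>Subexponential sequences against exponential decay\<close>

lemma subexponential_bound:
  assumes "subexponential y" "0 < r" "r < 1"
  shows "\<exists>K\<ge>0. \<forall>t. r ^ nat \<bar>t\<bar> * norm (y t) \<le> K"
proof -
  have s: "(\<lambda>t. r ^ nat \<bar>t\<bar> * norm (y t)) summable_on UNIV"
    using assms by (simp add: subexponential_def)
  have "r ^ nat \<bar>t\<bar> * norm (y t) \<le> (\<Sum>\<^sub>\<infinity>t. r ^ nat \<bar>t\<bar> * norm (y t))" for t
    using finite_sum_le_infsum[OF s, of "{t}"] assms by simp
  moreover have "0 \<le> (\<Sum>\<^sub>\<infinity>t. r ^ nat \<bar>t\<bar> * norm (y t))"
    using assms by (intro infsum_nonneg) simp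
  ultimately show ?thesis by blast
qed

text \<open>For \<open>r\<close> strictly between \<rho> and 1, \<open>norm (y j)\<close> is at most
  a constant times \<open>r^-(m+k)\<close>, which leaves the ratio
  \<open>q = \<rho> / r < 1\<close>. The offset \<open>m\<close> accommodates series centred at a
  time other than 0.\<close>

lemma subexponential_geometric:
  assumes "subexponential y" "0 < \<rho>" "\<rho> < 1"
  shows "\<exists>K q. 0 \<le> K \<and> 0 < q \<and> q < 1 \<and> (\<forall>k j. \<bar>j\<bar> \<le> int (m + k) \<longrightarrow> \<rho> ^ k * norm (y j) \<le> K * q ^ k)"
proof -
  define r where "r = (\<rho> + 1) / 2"
  have r: "0 < r" "r < 1" "\<rho> < r" using assms by (simp_all add: r_def)
  obtain K where K: "0 \<le> K" "\<And>t. r ^ nat \<bar>t\<bar> * norm (y t) \<le> K"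
    using subexponential_bound[OF assms(1) r(1,2)] by blast
  have "\<rho> ^ k * norm (y j) \<le> (K / r ^ m) * (\<rho> / r) ^ k" if "\<bar>j\<bar> \<le> int (m + k)" for k j
  proof -
    have "nat \<bar>j\<bar> \<le> m + k" using that by simp
    then have "r ^ (m + k) \<le> r ^ nat \<bar>j\<bar>" using r by (intro power_decreasing) auto
    then have "r ^ (m + k) * norm (y j) \<le> r ^ nat \<bar>j\<bar> * norm (y j)" by (intro mult_right_mono) auto
    also have "\<dots> \<le> K" by (rule K)
    finally have "norm (y j) \<le> K / r ^ (m + k)" using r by (simp add: pos_le_divide_eq mult.commute)
    then have "\<rho> ^ k * norm (y j) \<le> \<rho> ^ k * (K / r ^ (m + k))"
      using assms by (intro mult_left_mono) auto
    then show ?thesis by (simp add: power_add power_divide field_simps)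
  qed
  then show ?thesis using r assms K(1) by (intro exI[of _ "K / r ^ m"] exI[of _ "\<rho> / r"]) auto
qed

text \<open>The index map \<open>j\<close> stands for \<open>t - k\<close> and \<open>t + k\<close>
  in the series, with \<open>m = |t|\<close>, and for \<open>-k\<close> and \<open>k\<close> in the
  limits, with \<open>m = 0\<close>.\<close>

lemma subexponential_decay:
  fixes y :: "int \<Rightarrow> real ^ 'n"
  assumes "subexponential y" "0 < \<rho>" "\<rho> < 1"
    and T: "\<And>k v. norm (T k v) \<le> C * \<rho> ^ k * norm v"
    and j: "\<And>k. \<bar>j k\<bar> \<le> int (m + k)"
  shows "summable (\<lambda>k. T k (y (j k)) :: real ^ 'n)"
    and "(\<lambda>k. T k (y (j k))) \<longlonglongrightarrow> 0"
proof -
  obtain K q where q: "0 < q" "q < 1"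
    and K: "\<And>k j. \<bar>j\<bar> \<le> int (m + k) \<Longrightarrow> \<rho> ^ k * norm (y j) \<le> K * q ^ k"
    using subexponential_geometric[OF assms(1-3), of m] by blast
  have b: "norm (T k (y (j k))) \<le> \<bar>C\<bar> * K * q ^ k" for k
  proof -
    have "norm (T k (y (j k))) \<le> C * (\<rho> ^ k * norm (y (j k)))" using T[of k "y (j k)"] by (simp only: mult.assoc)
    also have "\<dots> \<le> \<bar>C\<bar> * (\<rho> ^ k * norm (y (j k)))" using assms(2) by (intro mult_right_mono) auto
    also have "\<dots> \<le> \<bar>C\<bar> * (K * q ^ k)" by (intro mult_left_mono K j) auto
    finally show ?thesis by (simp add: mult_ac)
  qed
  have "summable (\<lambda>k. \<bar>C\<bar> * K * q ^ k)"
    using q by (intro summable_mult summable_geometric) simp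
  then show "summable (\<lambda>k. T k (y (j k)))"
    by (rule summable_comparison_test') (rule b)
  then show "(\<lambda>k. T k (y (j k))) \<longlonglongrightarrow> 0" by (rule summable_LIMSEQ_zero)
qed

subsection \<open>The hyperbolic part\<close>

lemma column_space_idempotent:
  assumes "P ** P = P"
  shows "v \<in> column_space P \<longleftrightarrow> P *v v = v"
proof
  assume "P *v v = v"
  then show "v \<in> column_space P"
    unfolding column_space_def by (metis matrix_vector_mult_in_columnspace)
next
  have "span (columns P) \<subseteq> range ((*v) P)"
    by (rule span_minimal) (auto simp: columns_image_basis intro: linear_subspace_image)
  moreover assume "v \<in> column_space P"
  ultimately obtain w where "v = P *v w" by (auto simp: column_space_def)
  then show "P *v v = v" by (simp add: matrix_vector_mul_assoc assms)
qed

lemma matrix_vector_mult_suminf: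
  fixes A :: "real ^ 'n ^ 'm"
  assumes "summable f"
  shows "A *v (\<Sum>k. f k) = (\<Sum>k. A *v f k)"
  by (rule bounded_linear.suminf[OF matrix_vector_mul_bounded_linear assms])

text \<open>The recurrence carries zero forward in time; backward, \<open>D\<close> recovers
  \<open>y (t - 1)\<close> from \<open>A *v y (t - 1)\<close>. It is used over the reals for the
  hyperbolic part and over the complex numbers for the unit-modulus part.\<close>

lemma homogeneous_recurrence_zero:
  fixes A D :: "'a::semiring_1 ^ 'n ^ 'n" and y :: "int \<Rightarrow> 'a ^ 'n"
  assumes rec: "\<And>t. y t = A *v y (t - 1)" and inv: "\<And>t. (D ** A) *v y t = y t" and "y 0 = 0"
  shows "y t = 0"
proof (induction t rule: int_induct[where k = 0])
  case base
  then show ?case by (rule assms(3))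
next
  case (step1 i)
  then show ?case using rec[of "i + 1"] by simp
next
  case (step2 i)
  then show ?case
    using rec[of i] inv[of "i - 1"] by (simp flip: matrix_vector_mul_assoc)
qed

lemma drazin_projection_commute: "mod_proj \<Phi> (\<lambda>r. r \<noteq> 0) ** drazin \<Phi> = drazin \<Phi>"
  using drazin_spec[of \<Phi>] by (metis matrix_mul_assoc)

text \<open>The hypothesis enters at \<open>t = 0\<close>, where
  \<open>\<Phi> ** drazin \<Phi>\<close> is only a projection. For negative \<open>t\<close> a
  remaining factor \<open>drazin \<Phi>\<close> absorbs this projection.\<close>

lemma matpow_int_recurrence:
  assumes "mod_proj \<Phi> (\<lambda>r. r \<noteq> 0) *v v = v"
  shows "matpow_int \<Phi> t *v v = \<Phi> *v (matpow_int \<Phi> (t - 1) *v v)"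
proof (cases "t \<ge> 1")
  case True
  then have "nat t = Suc (nat (t - 1))" by simp
  then show ?thesis using True by (simp add: matpow_int_def matrix_vector_mul_assoc)
next
  case False
  define m where "m = nat (- t)"
  have m: "nat (- (t - 1)) = Suc m" using False by (simp add: m_def)
  have t: "matpow_int \<Phi> t = matpow (drazin \<Phi>) m"
    using False by (cases "t = 0") (simp_all add: matpow_int_def m_def)
  have "matpow (drazin \<Phi>) m *v v = mod_proj \<Phi> (\<lambda>r. r \<noteq> 0) *v (matpow (drazin \<Phi>) m *v v)"
    using assms by (cases m) (simp_all add: matrix_vector_mul_assoc matrix_mul_assoc drazin_projection_commute)
  also have "\<dots> = \<Phi> *v (matpow (drazin \<Phi>) (Suc m) *v v)"
    by (simp add: matrix_vector_mul_assoc matrix_mul_assoc drazin_spec(2))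
  finally show ?thesis using False m by (simp add: t) (simp add: matpow_int_def)
qed

lemma matpow_commute_vec:
  assumes "A ** P = P ** A"
  shows "P *v (matpow A k *v v) = matpow A k *v (P *v v)"
  by (simp add: matrix_vector_mul_assoc matpow_commute[OF assms])

text \<open>Inserting the idempotent \<open>?N\<close>, equal to both \<open>?D ** \<Phi>\<close>
  and \<open>\<Phi> ** ?D\<close>, reduces the claim to commutation with
  \<open>\<Phi>\<close>.\<close>

lemma drazin_mod_proj_commute: "drazin \<Phi> ** mod_proj \<Phi> Q = mod_proj \<Phi> Q ** drazin \<Phi>"
proof -
  let ?D = "drazin \<Phi>" and ?P = "mod_proj \<Phi> Q" and ?N = "mod_proj \<Phi> (\<lambda>r. r \<noteq> 0)"
  have NP: "?N ** ?P = ?P ** ?N" by (simp add: mod_proj_mult conj_commute)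
  have "?D ** ?P = ?D ** (?N ** ?P)" by (simp add: matrix_mul_assoc drazin_spec(3))
  also have "\<dots> = ?D ** ?P ** (\<Phi> ** ?D)" by (simp only: NP drazin_spec(2) matrix_mul_assoc)
  also have "\<dots> = ?D ** (?P ** \<Phi>) ** ?D" by (simp only: matrix_mul_assoc)
  also have "\<dots> = (?D ** \<Phi>) ** ?P ** ?D" by (simp only: mod_proj_commute matrix_mul_assoc)
  also have "\<dots> = ?P ** (?N ** ?D)" by (simp only: drazin_spec(1) NP matrix_mul_assoc)
  finally show ?thesis by (simp only: drazin_projection_commute)
qed

lemma mod_proj_matpow_int_commute:
  "mod_proj \<Phi> Q *v (matpow_int \<Phi> t *v v) = matpow_int \<Phi> t *v (mod_proj \<Phi> Q *v v)"
  by (simp add: matpow_int_def matpow_commute_vec mod_proj_commute drazin_mod_proj_commute)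

lemma homogeneous_solution:
  assumes rec: "\<And>t. y t = \<Phi> *v y (t - 1)"
    and inv: "\<And>t. mod_proj \<Phi> (\<lambda>r. r \<noteq> 0) *v y t = y t"
  shows "y t = matpow_int \<Phi> t *v y 0"
proof -
  let ?d = "\<lambda>t. y t - matpow_int \<Phi> t *v y 0"
  have "?d t = 0"
  proof (rule homogeneous_recurrence_zero[of ?d \<Phi> "drazin \<Phi>"])
    show "?d t = \<Phi> *v ?d (t - 1)" for t
      using rec[of t] matpow_int_recurrence[OF inv[of 0], of t]
      by (simp add: matrix_vector_mult_diff_distrib)
    show "(drazin \<Phi> ** \<Phi>) *v ?d t = ?d t" for t
      by (simp add: drazin_spec(1) matrix_vector_mult_diff_distrib inv mod_proj_matpow_int_commute)
  qed (simp add: matpow_int_def)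
  then show ?thesis by simp
qed

section \<open>Particular solutions inside and outside the unit circle\<close>

definition stable_part :: "real ^ 'n ^ 'n \<Rightarrow> (int \<Rightarrow> real ^ 'n) \<Rightarrow> int \<Rightarrow> real ^ 'n" where
  "stable_part \<Phi> \<epsilon> t = (\<Sum>k. matpow \<Phi> k *v (mod_proj \<Phi> (\<lambda>r. r < 1) *v \<epsilon> (t - int k)))"

definition unstable_part :: "real ^ 'n ^ 'n \<Rightarrow> (int \<Rightarrow> real ^ 'n) \<Rightarrow> int \<Rightarrow> real ^ 'n" where
  "unstable_part \<Phi> \<epsilon> t =
    (\<Sum>k. matpow (drazin \<Phi>) (Suc k) *v (mod_proj \<Phi> (\<lambda>r. r > 1) *v \<epsilon> (t + int (Suc k))))"

lemma stable_summable:
  assumes "subexponential \<epsilon>"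
  shows "summable (\<lambda>k. matpow \<Phi> k *v (mod_proj \<Phi> (\<lambda>r. r < 1) *v \<epsilon> (t - int k)))"
proof -
  obtain C \<rho> where \<rho>: "0 < \<rho>" "\<rho> < 1"
    and C: "\<And>k v. norm (matpow \<Phi> k *v (mod_proj \<Phi> (\<lambda>r. r < 1) *v v)) \<le> C * \<rho> ^ k * norm v"
    using lt1_decay by blast
  show ?thesis
    by (rule subexponential_decay(1)[OF assms \<rho> C, where m = "nat \<bar>t\<bar>"]) auto
qed

text \<open>Keeps the term \<open>k = 0\<close>, which \<open>unstable_part\<close> omits; the
  recurrence below splits it off.\<close>

lemma unstable_summable_lag:
  assumes "subexponential \<epsilon>"
  shows "summable (\<lambda>k. matpow (drazin \<Phi>) k *v (mod_proj \<Phi> (\<lambda>r. r > 1) *v \<epsilon> (t + int k)))"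
proof -
  obtain C \<rho> where \<rho>: "0 < \<rho>" "\<rho> < 1"
    and C: "\<And>k v. norm (matpow (drazin \<Phi>) k *v (mod_proj \<Phi> (\<lambda>r. r > 1) *v v)) \<le> C * \<rho> ^ k * norm v"
    using left_decay by blast
  show ?thesis
    by (rule subexponential_decay(1)[OF assms \<rho> C, where m = "nat \<bar>t\<bar>"]) auto
qed

lemma unstable_summable:
  assumes "subexponential \<epsilon>"
  shows "summable (\<lambda>k. matpow (drazin \<Phi>) (Suc k) *v (mod_proj \<Phi> (\<lambda>r. r > 1) *v \<epsilon> (t + int (Suc k))))"
  using unstable_summable_lag[OF assms, of \<Phi> t]
  by (subst summable_Suc_iff[of "\<lambda>k. matpow (drazin \<Phi>) k *v (mod_proj \<Phi> (\<lambda>r. r > 1) *v \<epsilon> (t + int k))"])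

text \<open>\<open>\<Phi>\<close> raises every power in the series at \<open>t - 1\<close> by one,
  which gives the series at \<open>t\<close> without its head \<open>k = 0\<close>.\<close>

lemma stable_part_recurrence:
  assumes "subexponential \<epsilon>"
  shows "stable_part \<Phi> \<epsilon> t = \<Phi> *v stable_part \<Phi> \<epsilon> (t - 1) + mod_proj \<Phi> (\<lambda>r. r < 1) *v \<epsilon> t"
proof -
  let ?f = "\<lambda>t k. matpow \<Phi> k *v (mod_proj \<Phi> (\<lambda>r. r < 1) *v \<epsilon> (t - int k))"
  have "?f t (Suc k) = \<Phi> *v ?f (t - 1) k" for k
    by (simp add: algebra_simps flip: matrix_vector_mul_assoc)
  then have "\<Phi> *v stable_part \<Phi> \<epsilon> (t - 1) = (\<Sum>k. ?f t (Suc k))"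
    unfolding stable_part_def using matrix_vector_mult_suminf[OF stable_summable[OF assms]] by simp
  also have "\<dots> = stable_part \<Phi> \<epsilon> t - ?f t 0"
    unfolding stable_part_def by (rule suminf_split_head[OF stable_summable[OF assms]])
  finally show ?thesis by simp
qed

lemma stable_part_proj:
  assumes "subexponential \<epsilon>"
  shows "mod_proj \<Phi> (\<lambda>r. r < 1) *v stable_part \<Phi> \<epsilon> t = stable_part \<Phi> \<epsilon> t"
  unfolding stable_part_def matrix_vector_mult_suminf[OF stable_summable[OF assms]]
  by (simp add: matpow_commute_vec mod_proj_commute mod_proj_mult_vec)

lemma drazin_left: "\<Phi> *v (drazin \<Phi> *v (mod_proj \<Phi> (\<lambda>r. r > 1) *v v)) = mod_proj \<Phi> (\<lambda>r. r > 1) *v v"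
    "drazin \<Phi> *v (\<Phi> *v (mod_proj \<Phi> (\<lambda>r. r > 1) *v v)) = mod_proj \<Phi> (\<lambda>r. r > 1) *v v"
proof -
  have "mod_proj \<Phi> (\<lambda>r. r \<noteq> 0 \<and> r > 1) = mod_proj \<Phi> (\<lambda>r. r > 1)" by (rule mod_proj_cong) auto
  then show "\<Phi> *v (drazin \<Phi> *v (mod_proj \<Phi> (\<lambda>r. r > 1) *v v)) = mod_proj \<Phi> (\<lambda>r. r > 1) *v v"
    "drazin \<Phi> *v (\<Phi> *v (mod_proj \<Phi> (\<lambda>r. r > 1) *v v)) = mod_proj \<Phi> (\<lambda>r. r > 1) *v v"
    by (simp_all add: matrix_vector_mul_assoc drazin_spec matrix_mul_assoc mod_proj_mult)
qed

text \<open>Here \<open>\<Phi>\<close> cancels one Drazin factor, so the series at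
  \<open>t - 1\<close> becomes the series at \<open>t\<close> with the additional term
  \<open>k = 0\<close>; this explains the minus sign.\<close>

lemma unstable_part_recurrence:
  assumes "subexponential \<epsilon>"
  shows "unstable_part \<Phi> \<epsilon> t =
    \<Phi> *v unstable_part \<Phi> \<epsilon> (t - 1) - mod_proj \<Phi> (\<lambda>r. r > 1) *v \<epsilon> t"
proof -
  let ?P = "mod_proj \<Phi> (\<lambda>r. r > 1)"
  let ?f = "\<lambda>k. matpow (drazin \<Phi>) k *v (?P *v \<epsilon> (t + int k))"
  have "\<Phi> *v (matpow (drazin \<Phi>) (Suc k) *v (?P *v \<epsilon> (t - 1 + int (Suc k)))) = ?f k" for k
  proof -
    have "matpow (drazin \<Phi>) k *v (?P *v w) = ?P *v (matpow (drazin \<Phi>) k *v w)" for w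
      by (rule matpow_commute_vec[symmetric]) (rule drazin_mod_proj_commute)
    then show ?thesis by (simp add: drazin_left flip: matrix_vector_mul_assoc)
  qed
  then have "\<Phi> *v unstable_part \<Phi> \<epsilon> (t - 1) = (\<Sum>k. ?f k)"
    unfolding unstable_part_def matrix_vector_mult_suminf[OF unstable_summable[OF assms]]
    by (simp only:)
  moreover have "unstable_part \<Phi> \<epsilon> t = (\<Sum>k. ?f k) - ?f 0"
    unfolding unstable_part_def by (rule suminf_split_head[OF unstable_summable_lag[OF assms]])
  ultimately show ?thesis by simp
qed

lemma unstable_part_proj:
  assumes "subexponential \<epsilon>"
  shows "mod_proj \<Phi> (\<lambda>r. r > 1) *v unstable_part \<Phi> \<epsilon> t = unstable_part \<Phi> \<epsilon> t"
  unfolding unstable_part_def matrix_vector_mult_suminf[OF unstable_summable[OF assms]]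
  by (simp add: matpow_commute_vec drazin_mod_proj_commute mod_proj_mult_vec del: matpow.simps)

lemma mod_proj_lt1_split:
  "mod_proj \<Phi> (\<lambda>r. r < 1) = mod_proj \<Phi> (\<lambda>r. r = 0) + mod_proj \<Phi> (\<lambda>r. 0 < r \<and> r < 1)"
proof -
  have "mod_proj \<Phi> (\<lambda>r. r < 1) = mod_proj \<Phi> (\<lambda>r. r = 0 \<or> 0 < r \<and> r < 1)"
    by (rule mod_proj_cong) auto
  also have "\<dots> = mod_proj \<Phi> (\<lambda>r. r = 0) + mod_proj \<Phi> (\<lambda>r. 0 < r \<and> r < 1)"
    by (rule mod_proj_add) auto
  finally show ?thesis .
qed

section \<open>General form of the hyperbolic parts\<close>

lemma stable_solution:
  fixes \<Phi> :: "real ^ 'n ^ 'n"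
  assumes \<epsilon>: "subexponential \<epsilon>" and x: "\<And>t. x t = \<Phi> *v x (t - 1) + \<epsilon> t"
  defines "v \<equiv> mod_proj \<Phi> (\<lambda>r. r < 1) *v x 0 - stable_part \<Phi> \<epsilon> 0"
  shows "mod_proj \<Phi> (\<lambda>r. 0 < r \<and> r < 1) *v v = v"
    and "mod_proj \<Phi> (\<lambda>r. r < 1) *v x t = matpow_int \<Phi> t *v v + stable_part \<Phi> \<epsilon> t"
proof -
  let ?P = "mod_proj \<Phi> (\<lambda>r. r < 1)" and ?R = "mod_proj \<Phi> (\<lambda>r. 0 < r \<and> r < 1)"
    and ?Z = "mod_proj \<Phi> (\<lambda>r. r = 0)"
  define y where "y t = ?P *v x t - stable_part \<Phi> \<epsilon> t" for t
  have rec: "y t = \<Phi> *v y (t - 1)" for t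
  proof -
    have "?P *v x t = \<Phi> *v (?P *v x (t - 1)) + ?P *v \<epsilon> t"
      by (subst x) (simp add: matrix_vector_right_distrib mod_proj_commute_vec)
    then show ?thesis
      using stable_part_recurrence[OF \<epsilon>, of \<Phi> t] by (simp add: y_def matrix_vector_mult_diff_distrib)
  qed
  have pow: "y t = matpow \<Phi> k *v y (t - int k)" for t k
  proof (induction k arbitrary: t)
    case (Suc k)
    show ?case using rec[of t] Suc[of "t - 1"] by (simp add: algebra_simps flip: matrix_vector_mul_assoc)
  qed simp
  \<comment> \<open>Going back N steps exhibits the factor \<open>\<Phi>^N\<close>, which
    annihilates the generalized kernel. This places \<open>v\<close> in the smaller space with
    eigenvalues of modulus strictly between 0 and 1.\<close>
  have Zy: "?Z *v y t = 0" for t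
  proof -
    have "?Z *v y t = (matpow \<Phi> CARD('n) ** ?Z) *v y (t - int CARD('n))"
      by (subst pow[of t "CARD('n)"])
        (simp add: matpow_commute_vec mod_proj_commute matrix_vector_mul_assoc matpow_commute)
    then show ?thesis by (simp add: mod_proj_zero_nilpotent)
  qed
  have "?P = ?Z + ?R" by (rule mod_proj_lt1_split)
  moreover have "?P *v y t = y t" for t
    by (simp add: y_def matrix_vector_mult_diff_distrib mod_proj_mult_vec stable_part_proj[OF \<epsilon>])
  ultimately have Ry: "?R *v y t = y t" for t
    using Zy[of t] by (simp add: matrix_vector_mult_add_rdistrib) (metis add_0)
  have "mod_proj \<Phi> (\<lambda>r. r \<noteq> 0 \<and> 0 < r \<and> r < 1) = ?R" by (rule mod_proj_cong) auto
  then have "mod_proj \<Phi> (\<lambda>r. r \<noteq> 0) *v y t = y t" for t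
    using Ry[of t] mod_proj_mult_vec[of \<Phi> "\<lambda>r. r \<noteq> 0" "\<lambda>r. 0 < r \<and> r < 1" "y t"] by simp
  from homogeneous_solution[of y \<Phi>, OF rec this] have "y t = matpow_int \<Phi> t *v y 0" .
  moreover have "v = y 0" by (simp add: v_def y_def)
  moreover have "?P *v x t = y t + stable_part \<Phi> \<epsilon> t" by (simp add: y_def)
  ultimately show "?R *v v = v" "?P *v x t = matpow_int \<Phi> t *v v + stable_part \<Phi> \<epsilon> t"
    using Ry[of 0] by simp_all
qed

lemma unstable_solution:
  assumes \<epsilon>: "subexponential \<epsilon>" and x: "\<And>t. x t = \<Phi> *v x (t - 1) + \<epsilon> t"
  defines "v \<equiv> mod_proj \<Phi> (\<lambda>r. r > 1) *v x 0 + unstable_part \<Phi> \<epsilon> 0"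
  shows "mod_proj \<Phi> (\<lambda>r. r > 1) *v v = v"
    and "mod_proj \<Phi> (\<lambda>r. r > 1) *v x t = matpow_int \<Phi> t *v v - unstable_part \<Phi> \<epsilon> t"
proof -
  let ?P = "mod_proj \<Phi> (\<lambda>r. r > 1)"
  define y where "y t = ?P *v x t + unstable_part \<Phi> \<epsilon> t" for t
  have rec: "y t = \<Phi> *v y (t - 1)" for t
  proof -
    have "?P *v x t = \<Phi> *v (?P *v x (t - 1)) + ?P *v \<epsilon> t"
      by (subst x) (simp add: matrix_vector_right_distrib mod_proj_commute_vec)
    then show ?thesis
      using unstable_part_recurrence[OF \<epsilon>, of \<Phi> t] by (simp add: y_def matrix_vector_right_distrib)
  qed
  have Py: "?P *v y t = y t" for t
    by (simp add: y_def matrix_vector_right_distrib mod_proj_mult_vec unstable_part_proj[OF \<epsilon>])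
  have "mod_proj \<Phi> (\<lambda>r. r \<noteq> 0 \<and> r > 1) = ?P" by (rule mod_proj_cong) auto
  then have "mod_proj \<Phi> (\<lambda>r. r \<noteq> 0) *v y t = y t" for t
    using Py[of t] mod_proj_mult_vec[of \<Phi> "\<lambda>r. r \<noteq> 0" "\<lambda>r. r > 1" "y t"] by simp
  from homogeneous_solution[of y \<Phi>, OF rec this] have "y t = matpow_int \<Phi> t *v y 0" .
  moreover have "v = y 0" by (simp add: v_def y_def)
  moreover have "?P *v x t = y t - unstable_part \<Phi> \<epsilon> t" by (simp add: y_def)
  ultimately show "?P *v v = v" "?P *v x t = matpow_int \<Phi> t *v v - unstable_part \<Phi> \<epsilon> t"
    using Py[of 0] by simp_all
qed

section \<open>Limits determining the hyperbolic vectors\<close>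

lemma stable_limit:
  fixes \<Phi> :: "real ^ 'n ^ 'n"
  assumes \<epsilon>: "subexponential \<epsilon>" and x: "\<And>t. x t = \<Phi> *v x (t - 1) + \<epsilon> t"
  shows "(\<lambda>n. matpow \<Phi> n *v (mod_proj \<Phi> (\<lambda>r. 0 < r \<and> r < 1) *v x (- int n)))
    \<longlonglongrightarrow> mod_proj \<Phi> (\<lambda>r. r < 1) *v x 0 - stable_part \<Phi> \<epsilon> 0"
proof -
  let ?P = "mod_proj \<Phi> (\<lambda>r. r < 1)" and ?R = "mod_proj \<Phi> (\<lambda>r. 0 < r \<and> r < 1)"
    and ?Z = "mod_proj \<Phi> (\<lambda>r. r = 0)"
  let ?f = "\<lambda>k. matpow \<Phi> k *v (?P *v \<epsilon> (- int k))"
  \<comment> \<open>Iterating the recurrence from time \<open>-n\<close> up to 0 produces the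
    partial sums of \<open>stable_part\<close> at time 0.\<close>
  have tel: "matpow \<Phi> n *v (?P *v x (- int n)) = ?P *v x 0 - (\<Sum>k<n. ?f k)" for n
  proof (induction n)
    case (Suc n)
    have "- int n - 1 = - int (Suc n)" by simp
    then have "x (- int n) = \<Phi> *v x (- int (Suc n)) + \<epsilon> (- int n)"
      using x[of "- int n"] by metis
    then have "?P *v x (- int n) = \<Phi> *v (?P *v x (- int (Suc n))) + ?P *v \<epsilon> (- int n)"
      by (simp only: matrix_vector_right_distrib mod_proj_commute_vec)
    then have "matpow \<Phi> n *v (?P *v x (- int n)) =
        matpow \<Phi> (Suc n) *v (?P *v x (- int (Suc n))) + ?f n"
      unfolding matpow_Suc_right by (simp add: matrix_vector_right_distrib flip: matrix_vector_mul_assoc)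
    then show ?case using Suc by (simp add: algebra_simps)
  qed simp
  have "(\<lambda>n. \<Sum>k<n. ?f k) \<longlonglongrightarrow> stable_part \<Phi> \<epsilon> 0"
    using summable_LIMSEQ[OF stable_summable[OF \<epsilon>, of \<Phi> 0]] by (simp add: stable_part_def)
  then have lim: "(\<lambda>n. matpow \<Phi> n *v (?P *v x (- int n))) \<longlonglongrightarrow> ?P *v x 0 - stable_part \<Phi> \<epsilon> 0"
    unfolding tel by (intro tendsto_intros)
  have PZR: "?P = ?Z + ?R" by (rule mod_proj_lt1_split)
  \<comment> \<open>From \<open>n = N\<close> on, the generalized kernel contributes nothing, so the
    projection for modulus below 1 may be replaced by \<open>?R\<close> in the limit.\<close>
  have "matpow \<Phi> n *v (?Z *v w) = 0" if "n \<ge> CARD('n)" for n w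
    by (rule matpow_mono_kernel[OF _ that])
      (simp add: matrix_vector_mul_assoc mod_proj_zero_nilpotent)
  then have "\<forall>\<^sub>F n in sequentially. matpow \<Phi> n *v (?P *v x (- int n)) = matpow \<Phi> n *v (?R *v x (- int n))"
    by (intro eventually_sequentiallyI[of "CARD('n)"])
      (simp add: PZR matrix_vector_mult_add_rdistrib matrix_vector_right_distrib)
  then show ?thesis using lim by (simp add: tendsto_cong)
qed

lemma unstable_limit:
  assumes \<epsilon>: "subexponential \<epsilon>" and x: "\<And>t. x t = \<Phi> *v x (t - 1) + \<epsilon> t"
  shows "(\<lambda>n. matpow (drazin \<Phi>) n *v (mod_proj \<Phi> (\<lambda>r. r > 1) *v x (int n)))
    \<longlonglongrightarrow> mod_proj \<Phi> (\<lambda>r. r > 1) *v x 0 + unstable_part \<Phi> \<epsilon> 0"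
proof -
  let ?P = "mod_proj \<Phi> (\<lambda>r. r > 1)"
  let ?f = "\<lambda>k. matpow (drazin \<Phi>) (Suc k) *v (?P *v \<epsilon> (int (Suc k)))"
  have tel: "matpow (drazin \<Phi>) n *v (?P *v x (int n)) = ?P *v x 0 + (\<Sum>k<n. ?f k)" for n
  proof (induction n)
    case (Suc n)
    have "?P *v x (int (Suc n)) = \<Phi> *v (?P *v x (int n)) + ?P *v \<epsilon> (int (Suc n))"
      by (subst x) (simp add: matrix_vector_right_distrib mod_proj_commute_vec)
    then have "matpow (drazin \<Phi>) (Suc n) *v (?P *v x (int (Suc n))) =
        matpow (drazin \<Phi>) n *v (drazin \<Phi> *v (\<Phi> *v (?P *v x (int n)))) + ?f n"
      unfolding matpow_Suc_right by (simp add: matrix_vector_right_distrib flip: matrix_vector_mul_assoc)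
    then show ?case using Suc by (simp add: drazin_left del: matpow.simps)
  qed simp
  have "(\<lambda>n. \<Sum>k<n. ?f k) \<longlonglongrightarrow> unstable_part \<Phi> \<epsilon> 0"
    using summable_LIMSEQ[OF unstable_summable[OF \<epsilon>, of \<Phi> 0]]
    by (simp add: unstable_part_def del: matpow.simps)
  then show ?thesis unfolding tel by (intro tendsto_intros)
qed

lemma stable_limit_subexponential:
  assumes "subexponential x"
  shows "(\<lambda>n. matpow \<Phi> n *v (mod_proj \<Phi> (\<lambda>r. 0 < r \<and> r < 1) *v x (- int n))) \<longlonglongrightarrow> 0"
proof -
  let ?R = "mod_proj \<Phi> (\<lambda>r. 0 < r \<and> r < 1)"
  obtain C \<rho> where \<rho>: "0 < \<rho>" "\<rho> < 1"
    and C: "\<And>k v. norm (matpow \<Phi> k *v (mod_proj \<Phi> (\<lambda>r. r < 1) *v v)) \<le> C * \<rho> ^ k * norm v"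
    using lt1_decay by blast
  have lim: "(\<lambda>n. matpow \<Phi> n *v (mod_proj \<Phi> (\<lambda>r. r < 1) *v x (- int n))) \<longlonglongrightarrow> 0"
    by (rule subexponential_decay(2)[OF assms \<rho> C, where m = 0]) auto
  have "mod_proj \<Phi> (\<lambda>r. (0 < r \<and> r < 1) \<and> r < 1) = ?R" by (rule mod_proj_cong) auto
  \<comment> \<open>\<open>?R\<close> absorbs the projection for modulus below 1 and commutes with
    \<open>\<Phi>\<close>, so the sequence is the image under \<open>?R\<close> of one that tends to
    0.\<close>
  then have "matpow \<Phi> n *v (?R *v v) = ?R *v (matpow \<Phi> n *v (mod_proj \<Phi> (\<lambda>r. r < 1) *v v))" for n v
    by (simp add: matpow_commute_vec mod_proj_commute mod_proj_mult_vec)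
  then show ?thesis
    using bounded_linear.tendsto[OF matrix_vector_mul_bounded_linear lim, of ?R] by simp
qed

lemma unstable_limit_subexponential:
  assumes "subexponential x"
  shows "(\<lambda>n. matpow (drazin \<Phi>) n *v (mod_proj \<Phi> (\<lambda>r. r > 1) *v x (int n))) \<longlonglongrightarrow> 0"
proof -
  obtain C \<rho> where \<rho>: "0 < \<rho>" "\<rho> < 1"
    and C: "\<And>k v. norm (matpow (drazin \<Phi>) k *v (mod_proj \<Phi> (\<lambda>r. r > 1) *v v)) \<le> C * \<rho> ^ k * norm v"
    using left_decay by blast
  show ?thesis
    by (rule subexponential_decay(2)[OF assms \<rho> C, where m = 0]) auto
qed

subsection \<open>The part of unit modulus\<close>

lemma cumulation_recurrence:
  "cumulation \<theta> y t = exp (- \<i> * complex_of_real \<theta>) *s cumulation \<theta> y (t - 1) + y t"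
proof -
  define e where "e k = exp (- \<i> * complex_of_real \<theta> * of_int k)" for k :: int
  define z where "z = exp (- \<i> * complex_of_real \<theta>)"
  have e0: "e 0 = 1" by (simp add: e_def)
  have e1: "z * e k = e (k + 1)" for k
    by (simp add: e_def z_def algebra_simps flip: exp_add)
  \<comment> \<open>Both closed forms include \<open>t = 0\<close>, where their sums are empty.
    Hence the step from \<open>t - 1\<close> to \<open>t\<close> stays within one of them.\<close>
  have nonneg: "cumulation \<theta> y t = (\<Sum>s=1..t. e (t - s) *s y s)" if "t \<ge> 0" for t
    using that by (simp add: cumulation_def e_def)
  have nonpos: "cumulation \<theta> y t = - (\<Sum>s=0..-t-1. e (t + s) *s y (- s))" if "t \<le> 0" for t
    using that by (simp add: cumulation_def e_def)
  show ?thesis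
  proof (cases "t \<ge> 1")
    case True
    then have ins: "{1..t} = insert t {1..t - 1}" by auto
    have "cumulation \<theta> y t = y t + (\<Sum>s=1..t - 1. e (t - s) *s y s)"
      using True by (simp add: nonneg ins e0)
    also have "(\<Sum>s=1..t - 1. e (t - s) *s y s) =
        z *s cumulation \<theta> y (t - 1)"
      using True by (simp add: nonneg vec.scale_sum_right vector_smult_assoc e1)
    finally show ?thesis by (simp add: z_def)
  next
    case False
    then have ins: "{0..- (t - 1) - 1} = insert (- t) {0..- t - 1}" by auto
    have "z *s cumulation \<theta> y (t - 1) =
        - (\<Sum>s=0..- (t - 1) - 1. e (t + s) *s y (- s))"
      using False nonpos[of "t - 1"]
      by (simp add: vec.scale_sum_right vector_smult_assoc e1 vec.scale_minus_right)
    also have "\<dots> = - y t + cumulation \<theta> y t"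
      using False by (simp only: ins) (simp add: nonpos e0)
    finally show ?thesis by (simp add: z_def)
  qed
qed

lemma cumulation_zero [simp]: "cumulation \<theta> y 0 = 0"
  by (simp add: cumulation_def)

lemma residual_recurrence:
  "residual \<theta> v t = exp (- \<i> * complex_of_real \<theta>) *s residual \<theta> v (t - 1)"
  by (simp add: residual_def vector_smult_assoc algebra_simps flip: exp_add)

text \<open>Split \<open>M = z + (M - z)\<close>. The second part turns the \<open>k\<close>-th term
  at \<open>t - 1\<close> into \<open>(M - z)^(k+1) P\<close> applied to \<open>Y k (t - 1)\<close>,
  which is exactly the input of \<open>Y (k + 1)\<close>. Only a boundary term at \<open>d\<close>
  remains, and it vanishes once \<open>(M - z)^d P = 0\<close>.\<close>

lemma nilpotent_sum_recurrence:
  fixes M P :: "'a::field ^ 'n ^ 'n" and Y G :: "nat \<Rightarrow> int \<Rightarrow> 'a ^ 'n"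
  assumes "\<And>k t. Y k t = z *s Y k (t - 1) + G k t" "\<And>k t. G (Suc k) t = Y k (t - 1)"
  shows "(\<Sum>k<d. (matpow (M - mat z) k ** P) *v Y k t) + (matpow (M - mat z) d ** P) *v G d t =
    M *v (\<Sum>k<d. (matpow (M - mat z) k ** P) *v Y k (t - 1)) + P *v G 0 t"
proof (induction d)
  case (Suc d)
  let ?A = "\<lambda>k. matpow (M - mat z) k ** P"
  have "M *v (?A d *v w) = z *s (?A d *v w) + ?A (Suc d) *v w" for w
    by (simp add: matrix_vector_mult_diff_rdistrib mat_vec_mult flip: matrix_vector_mul_assoc)
  moreover have "?A d *v Y d t = z *s (?A d *v Y d (t - 1)) + ?A d *v G d t"
    by (subst assms(1)) (simp add: matrix_vector_right_distrib vector_scalar_commute)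
  ultimately show ?case
    using Suc by (simp add: assms(2) matrix_vector_right_distrib algebra_simps del: matpow.simps)
qed simp

definition unit_part :: "real ^ 'n ^ 'n \<Rightarrow> (int \<Rightarrow> real ^ 'n) \<Rightarrow> real ^ 'n \<Rightarrow> int \<Rightarrow> complex ^ 'n" where
  "unit_part \<Phi> \<epsilon> v t = (\<Sum>\<theta>\<in>unit_angles \<Phi>.
    let z = exp (- \<i> * complex_of_real \<theta>) in
    \<Sum>k=1..eigen_index (complex_mat \<Phi>) z.
      (matpow (complex_mat \<Phi> - mat z) (k - 1) ** spectral_proj (complex_mat \<Phi>) {z}) *v
      ((cumulation \<theta> \<circ> backshift) ^^ (k - 1))
        (\<lambda>s. residual \<theta> (complex_vec v) s + cumulation \<theta> (\<lambda>r. complex_vec (\<epsilon> r)) s) t)"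

text \<open>As \<open>exp (- \<i> \<theta>)\<close> is the conjugate of \<open>cis \<theta>\<close>,
  the angle is recovered as \<open>Arg (cnj z)\<close>; the half-open interval is the range of
  \<open>Arg\<close>.\<close>

lemma bij_betw_unit_angles:
  "bij_betw (\<lambda>\<theta>. exp (- \<i> * complex_of_real \<theta>)) (unit_angles \<Phi>)
    {z \<in> eigenvals (complex_mat \<Phi>). cmod z = 1}"
proof -
  have c: "exp (- \<i> * complex_of_real \<theta>) = cnj (cis \<theta>)" for \<theta>
    by (simp add: cis_conv_exp exp_cnj)
  have Arg: "Arg (cis \<theta>) = \<theta>" if "-pi < \<theta>" "\<theta> \<le> pi" for \<theta>
    using that by (intro cis_Arg_unique) (auto simp: sgn_eq)
  show ?thesis
  proof (rule bij_betw_byWitness[where f' = "\<lambda>z. Arg (cnj z)"])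
    show "\<forall>\<theta>\<in>unit_angles \<Phi>. Arg (cnj (exp (- \<i> * complex_of_real \<theta>))) = \<theta>"
      unfolding c by (auto simp: unit_angles_def Arg)
    have w: "exp (- \<i> * complex_of_real (Arg (cnj z))) = z" if "cmod z = 1" for z
    proof -
      have "z \<noteq> 0" using that by auto
      then have "cis (Arg (cnj z)) = cnj z" using that by (simp add: cis_Arg sgn_eq)
      then show ?thesis unfolding c by simp
    qed
    show "\<forall>z\<in>{z \<in> eigenvals (complex_mat \<Phi>). cmod z = 1}.
        exp (- \<i> * complex_of_real (Arg (cnj z))) = z"
      using w by blast
    show "(\<lambda>\<theta>. exp (- \<i> * complex_of_real \<theta>)) ` unit_angles \<Phi>
        \<subseteq> {z \<in> eigenvals (complex_mat \<Phi>). cmod z = 1}"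
      unfolding unit_angles_def c by auto
    show "(\<lambda>z. Arg (cnj z)) ` {z \<in> eigenvals (complex_mat \<Phi>). cmod z = 1} \<subseteq> unit_angles \<Phi>"
      using Arg_bounded w by (auto simp: unit_angles_def)
  qed
qed

text \<open>These properties (recurrence, value at 0, range) determine the solution of unit modulus.
  Each is checked angle by angle, and the projections for the single angles add up to the one for
  modulus 1.\<close>

lemma unit_part_recurrence:
  "unit_part \<Phi> \<epsilon> v t =
    complex_mat \<Phi> *v unit_part \<Phi> \<epsilon> v (t - 1) + complex_vec (mod_proj \<Phi> (\<lambda>r. r = 1) *v \<epsilon> t)"
  "unit_part \<Phi> \<epsilon> v 0 = complex_vec (mod_proj \<Phi> (\<lambda>r. r = 1) *v v)"
  "complex_mat (mod_proj \<Phi> (\<lambda>r. r = 1)) *v unit_part \<Phi> \<epsilon> v t = unit_part \<Phi> \<epsilon> v t"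
proof -
  let ?M = "complex_mat \<Phi>"
  define Z where "Z \<theta> = exp (- \<i> * complex_of_real \<theta>)" for \<theta>
  define P where "P \<theta> = spectral_proj ?M {Z \<theta>}" for \<theta>
  define Y where "Y \<theta> k = ((cumulation \<theta> \<circ> backshift) ^^ k)
    (\<lambda>s. residual \<theta> (complex_vec v) s + cumulation \<theta> (\<lambda>r. complex_vec (\<epsilon> r)) s)" for \<theta> k
  \<comment> \<open>The input that drives \<open>Y \<theta> k\<close>: the noise for
    \<open>k = 0\<close>, and the delayed previous level otherwise.\<close>
  define G where "G \<theta> k t = (case k of 0 \<Rightarrow> complex_vec (\<epsilon> t) | Suc j \<Rightarrow> Y \<theta> j (t - 1))" for \<theta> k t
  define d where "d \<theta> = eigen_index ?M (Z \<theta>)" for \<theta>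
  define U where "U \<theta> t = (\<Sum>k<d \<theta>. (matpow (?M - mat (Z \<theta>)) k ** P \<theta>) *v Y \<theta> k t)" for \<theta> t
  have ZE: "Z \<theta> \<in> eigenvals ?M" if "\<theta> \<in> unit_angles \<Phi>" for \<theta>
    using that by (auto simp: unit_angles_def Z_def)
  have sum: "unit_part \<Phi> \<epsilon> v t = (\<Sum>\<theta>\<in>unit_angles \<Phi>. U \<theta> t)" for t
    by (simp add: unit_part_def U_def Let_def sum.atLeast1_atMost_eq P_def Y_def d_def Z_def)
  have Y: "Y \<theta> k t = Z \<theta> *s Y \<theta> k (t - 1) + G \<theta> k t" for \<theta> k t
  proof (cases k)
    case 0
    show ?thesis
      unfolding Y_def G_def Z_def 0 funpow.simps id_apply
      by (subst residual_recurrence, subst cumulation_recurrence) (simp add: vec.scale_right_distrib)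
  next
    case (Suc j)
    have "Y \<theta> k = cumulation \<theta> (backshift (Y \<theta> j))" by (simp add: Y_def Suc)
    then show ?thesis
      using cumulation_recurrence[of \<theta> "backshift (Y \<theta> j)" t]
      by (simp add: Suc G_def Z_def backshift_def)
  qed
  have nil: "matpow (?M - mat (Z \<theta>)) (d \<theta>) ** P \<theta> = 0" if "\<theta> \<in> unit_angles \<Phi>" for \<theta>
    unfolding d_def P_def using spectral_proj_nilpotent(1)[OF ZE[OF that]] .
  have Urec: "U \<theta> t = ?M *v U \<theta> (t - 1) + P \<theta> *v complex_vec (\<epsilon> t)" if "\<theta> \<in> unit_angles \<Phi>" for \<theta> t
  proof -
    have "G \<theta> (Suc k) s = Y \<theta> k (s - 1)" for k s by (simp add: G_def)
    from nilpotent_sum_recurrence[where Y = "Y \<theta>" and z = "Z \<theta>" and G = "G \<theta>" and M = ?M and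
        P = "P \<theta>" and d = "d \<theta>" and t = t, OF Y this]
    show ?thesis unfolding nil[OF that] U_def by (simp add: G_def)
  qed
  have U0: "U \<theta> 0 = P \<theta> *v complex_vec v" if "\<theta> \<in> unit_angles \<Phi>" for \<theta>
  proof -
    \<comment> \<open>Cumulations vanish at time 0, so only the residual term in level 0
      survives.\<close>
    have "Y \<theta> k 0 = (if k = 0 then complex_vec v else 0)" for k
      by (cases k) (simp_all add: Y_def residual_def)
    then have "U \<theta> 0 = (\<Sum>k<d \<theta>. if k = 0 then P \<theta> *v complex_vec v else 0)"
      unfolding U_def by (intro sum.cong) auto
    \<comment> \<open>An empty sum does no harm: for \<open>d \<theta> = 0\<close>, nilpotency with
      exponent 0 says that the projection itself is 0.\<close>
    moreover have "P \<theta> = 0" if "d \<theta> = 0" using nil[OF \<open>\<theta> \<in> unit_angles \<Phi>\<close>] that by simp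
    ultimately show ?thesis by auto
  qed
  have PU: "P \<theta> *v U \<theta> t = U \<theta> t" if "\<theta> \<in> unit_angles \<Phi>" for \<theta> t
  proof -
    have "P \<theta> ** (matpow (?M - mat (Z \<theta>)) k ** P \<theta>) = matpow (?M - mat (Z \<theta>)) k ** P \<theta>" for k
    proof -
      have "P \<theta> ** P \<theta> = P \<theta>"
        unfolding P_def using spectral_proj_mult[of "{Z \<theta>}" ?M "{Z \<theta>}"] ZE[OF that] by simp
      moreover have "matpow (?M - mat (Z \<theta>)) k ** P \<theta> = P \<theta> ** matpow (?M - mat (Z \<theta>)) k"
        unfolding P_def using ZE[OF that]
        by (intro matpow_diff_mat_commute spectral_proj_commute) auto
      ultimately show ?thesis by (metis matrix_mul_assoc)
    qed
    then show ?thesis by (simp add: U_def matrix_vector_mult_sum matrix_vector_mul_assoc)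
  qed
  let ?P1 = "mod_proj \<Phi> (\<lambda>r. r = 1)" and ?A = "{z \<in> eigenvals ?M. cmod z = 1}"
  have "complex_mat ?P1 = (\<Sum>z\<in>?A. spectral_proj ?M {z})"
    unfolding complex_mod_proj by (rule spectral_proj_sum) auto
  also have "\<dots> = (\<Sum>\<theta>\<in>unit_angles \<Phi>. P \<theta>)"
    unfolding P_def Z_def by (rule sum.reindex_bij_betw[OF bij_betw_unit_angles, symmetric])
  finally have P1: "complex_mat ?P1 = (\<Sum>\<theta>\<in>unit_angles \<Phi>. P \<theta>)" .
  show "unit_part \<Phi> \<epsilon> v t = ?M *v unit_part \<Phi> \<epsilon> v (t - 1) + complex_vec (?P1 *v \<epsilon> t)"
    unfolding sum complex_mat_vec P1 matrix_sum_vector_mult matrix_vector_mult_sum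
      sum.distrib[symmetric]
    by (intro sum.cong Urec) auto
  show "unit_part \<Phi> \<epsilon> v 0 = complex_vec (?P1 *v v)"
    unfolding sum complex_mat_vec P1 matrix_sum_vector_mult
    by (intro sum.cong U0) auto
  have "complex_mat ?P1 *v U \<theta> t = U \<theta> t" if "\<theta> \<in> unit_angles \<Phi>" for \<theta>
  proof -
    have "Z \<theta> \<in> ?A"
      using bij_betw_unit_angles[of \<Phi>] that by (auto simp: bij_betw_def Z_def)
    then have "?A \<inter> {Z \<theta>} = {Z \<theta>}" by blast
    then have "complex_mat ?P1 ** P \<theta> = P \<theta>"
      unfolding complex_mod_proj P_def
      using spectral_proj_mult[of ?A ?M "{Z \<theta>}"] ZE[OF that] by auto
    then show ?thesis using PU[OF that, of t] by (metis matrix_vector_mul_assoc)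
  qed
  then show "complex_mat ?P1 *v unit_part \<Phi> \<epsilon> v t = unit_part \<Phi> \<epsilon> v t"
    unfolding sum matrix_vector_mult_sum by (intro sum.cong) auto
qed

text \<open>Both sides satisfy the same recurrence within the range of \<open>?P\<close>, where the
  Drazin inverse inverts \<open>\<Phi>\<close>, and they agree at time 0.\<close>

lemma unit_solution:
  assumes x: "\<And>t. x t = \<Phi> *v x (t - 1) + \<epsilon> t"
  shows "complex_vec (mod_proj \<Phi> (\<lambda>r. r = 1) *v x t) =
    unit_part \<Phi> \<epsilon> (mod_proj \<Phi> (\<lambda>r. r = 1) *v x 0) t"
proof -
  let ?P = "mod_proj \<Phi> (\<lambda>r. r = 1)" and ?M = "complex_mat \<Phi>" and ?D = "complex_mat (drazin \<Phi>)"
  let ?d = "\<lambda>t. complex_vec (?P *v x t) - unit_part \<Phi> \<epsilon> (?P *v x 0) t"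
  have "?d t = 0"
  proof (rule homogeneous_recurrence_zero[of ?d ?M ?D])
    show "?d t = ?M *v ?d (t - 1)" for t
    proof -
      have "?P *v x t = \<Phi> *v (?P *v x (t - 1)) + ?P *v \<epsilon> t"
        by (subst x) (simp add: matrix_vector_right_distrib mod_proj_commute_vec)
      then show ?thesis
        using unit_part_recurrence(1)[of \<Phi> \<epsilon> "?P *v x 0" t]
        by (simp add: complex_mat_vec[of \<Phi>] matrix_vector_mult_diff_distrib)
    qed
    show "(?D ** ?M) *v ?d t = ?d t" for t
    proof -
      have "mod_proj \<Phi> (\<lambda>r. r \<noteq> 0 \<and> r = 1) = ?P" by (rule mod_proj_cong) auto
      then have QP: "?D ** ?M ** complex_mat ?P = complex_mat ?P"
        by (simp add: drazin_spec(1) mod_proj_mult flip: complex_mat_mult)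
      have "complex_mat ?P *v ?d t = ?d t"
        by (simp add: matrix_vector_mult_diff_distrib unit_part_recurrence(3) mod_proj_mult_vec
            flip: complex_mat_vec)
      then show ?thesis using QP by (metis matrix_vector_mul_assoc)
    qed
    show "?d 0 = 0" by (simp add: unit_part_recurrence(2) mod_proj_mult_vec)
  qed
  then show ?thesis by simp
qed

subsection \<open>Characterization of the solutions\<close>

lemma proj_eq_mod_proj:
  "proj_lt1 \<Phi> = mod_proj \<Phi> (\<lambda>r. r < 1)" "proj_left \<Phi> = mod_proj \<Phi> (\<lambda>r. r > 1)"
  "proj_unit \<Phi> = mod_proj \<Phi> (\<lambda>r. r = 1)" "proj_right \<Phi> = mod_proj \<Phi> (\<lambda>r. 0 < r \<and> r < 1)"
  by (simp_all add: proj_lt1_def proj_left_def proj_unit_def proj_right_def mod_proj_def)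

lemma solution_formulas_alt:
  "solution_formulas \<Phi> \<epsilon> x vr vl vu \<longleftrightarrow>
    mod_proj \<Phi> (\<lambda>r. 0 < r \<and> r < 1) *v vr = vr \<and> mod_proj \<Phi> (\<lambda>r. r > 1) *v vl = vl \<and>
    mod_proj \<Phi> (\<lambda>r. r = 1) *v vu = vu \<and>
    (\<forall>t. mod_proj \<Phi> (\<lambda>r. r < 1) *v x t = matpow_int \<Phi> t *v vr + stable_part \<Phi> \<epsilon> t \<and>
      mod_proj \<Phi> (\<lambda>r. r > 1) *v x t = matpow_int \<Phi> t *v vl - unstable_part \<Phi> \<epsilon> t \<and>
      complex_vec (mod_proj \<Phi> (\<lambda>r. r = 1) *v x t) = unit_part \<Phi> \<epsilon> vu t)"
proof -
  have "matpow_int \<Phi> (- int (Suc k)) = matpow (drazin \<Phi>) (Suc k)" for k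
    by (simp only: matpow_int_def) (simp add: nat_add_distrib)
  then show ?thesis
    unfolding solution_formulas_def stable_part_def unstable_part_def unit_part_def
      proj_eq_mod_proj
    by (simp only: column_space_idempotent mod_proj_mult conj_absorb)
qed

lemma mod_proj_decomposition:
  "x = mod_proj \<Phi> (\<lambda>r. r < 1) *v x + mod_proj \<Phi> (\<lambda>r. r > 1) *v x + mod_proj \<Phi> (\<lambda>r. r = 1) *v x"
proof -
  have "mat 1 = mod_proj \<Phi> (\<lambda>r. (r < 1 \<or> r > 1) \<or> r = 1)"
    unfolding mod_proj_True[of \<Phi>, symmetric] by (rule mod_proj_cong) auto
  also have "\<dots> = mod_proj \<Phi> (\<lambda>r. r < 1 \<or> r > 1) + mod_proj \<Phi> (\<lambda>r. r = 1)"
    by (rule mod_proj_add) auto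
  also have "mod_proj \<Phi> (\<lambda>r. r < 1 \<or> r > 1) = mod_proj \<Phi> (\<lambda>r. r < 1) + mod_proj \<Phi> (\<lambda>r. r > 1)"
    by (rule mod_proj_add) auto
  finally have "mat 1 *v x = (mod_proj \<Phi> (\<lambda>r. r < 1) + mod_proj \<Phi> (\<lambda>r. r > 1) +
    mod_proj \<Phi> (\<lambda>r. r = 1)) *v x" by simp
  then show ?thesis by (simp add: matrix_vector_mult_add_rdistrib)
qed

text \<open>Each formula yields the recurrence projected to its part of the spectrum; the three
  projections sum to the identity.\<close>

lemma solution_formulas_imp_recurrence:
  assumes \<epsilon>: "subexponential \<epsilon>" and sol: "solution_formulas \<Phi> \<epsilon> x vr vl vu"
  shows "x t = \<Phi> *v x (t - 1) + \<epsilon> t"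
proof -
  let ?S = "mod_proj \<Phi> (\<lambda>r. r < 1)" and ?U = "mod_proj \<Phi> (\<lambda>r. r > 1)"
    and ?C = "mod_proj \<Phi> (\<lambda>r. r = 1)" and ?N = "mod_proj \<Phi> (\<lambda>r. r \<noteq> 0)"
  have vr: "mod_proj \<Phi> (\<lambda>r. 0 < r \<and> r < 1) *v vr = vr" and vl: "?U *v vl = vl"
    and S: "\<And>t. ?S *v x t = matpow_int \<Phi> t *v vr + stable_part \<Phi> \<epsilon> t"
    and U: "\<And>t. ?U *v x t = matpow_int \<Phi> t *v vl - unstable_part \<Phi> \<epsilon> t"
    and C: "\<And>t. complex_vec (?C *v x t) = unit_part \<Phi> \<epsilon> vu t"
    using sol unfolding solution_formulas_alt by auto
  have "mod_proj \<Phi> (\<lambda>r. r \<noteq> 0 \<and> 0 < r \<and> r < 1) = mod_proj \<Phi> (\<lambda>r. 0 < r \<and> r < 1)"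
    "mod_proj \<Phi> (\<lambda>r. r \<noteq> 0 \<and> r > 1) = ?U"
    by (rule mod_proj_cong, auto)+
  then have "?N *v vr = vr" "?N *v vl = vl"
    using mod_proj_mult_vec[of \<Phi> "\<lambda>r. r \<noteq> 0" "\<lambda>r. 0 < r \<and> r < 1" vr]
      mod_proj_mult_vec[of \<Phi> "\<lambda>r. r \<noteq> 0" "\<lambda>r. r > 1" vl] vr vl by simp_all
  note pow = this[THEN matpow_int_recurrence, of t]
  have s: "?S *v x t = \<Phi> *v (?S *v x (t - 1)) + ?S *v \<epsilon> t"
    using stable_part_recurrence[OF \<epsilon>, of \<Phi> t] pow(1)
    by (simp add: S matrix_vector_right_distrib)
  have u: "?U *v x t = \<Phi> *v (?U *v x (t - 1)) + ?U *v \<epsilon> t"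
    using unstable_part_recurrence[OF \<epsilon>, of \<Phi> t] pow(2)
    by (simp add: U matrix_vector_mult_diff_distrib)
  \<comment> \<open>The recurrence is obtained over the complex numbers and pulled back by
    injectivity of \<open>complex_vec\<close>.\<close>
  have "complex_vec (?C *v x t) = complex_vec (\<Phi> *v (?C *v x (t - 1)) + ?C *v \<epsilon> t)"
    using unit_part_recurrence(1)[of \<Phi> \<epsilon> vu t] by (simp add: C complex_mat_vec[of \<Phi>])
  then have c: "?C *v x t = \<Phi> *v (?C *v x (t - 1)) + ?C *v \<epsilon> t"
    unfolding complex_vec_inject .
  have "x t = ?S *v x t + ?U *v x t + ?C *v x t" by (rule mod_proj_decomposition)
  also have "\<dots> = \<Phi> *v (?S *v x (t - 1) + ?U *v x (t - 1) + ?C *v x (t - 1)) +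
      (?S *v \<epsilon> t + ?U *v \<epsilon> t + ?C *v \<epsilon> t)"
    unfolding s u c by (simp add: matrix_vector_right_distrib)
  also have "\<dots> = \<Phi> *v x (t - 1) + \<epsilon> t" by (simp flip: mod_proj_decomposition)
  finally show ?thesis .
qed

text \<open>At \<open>t = 0\<close> the power of \<open>\<Phi>\<close> is the identity and the
  unit-modulus part reduces to \<open>vu\<close>, so the formulas leave one candidate for each
  vector; the solution lemmas show that these candidates work. Existence in (ii) and uniqueness in
  (iii) both follow.\<close>

lemma solution_formulas_iff:
  assumes \<epsilon>: "subexponential \<epsilon>" and x: "\<And>t. x t = \<Phi> *v x (t - 1) + \<epsilon> t"
  shows "solution_formulas \<Phi> \<epsilon> x vr vl vu \<longleftrightarrow>
    vr = mod_proj \<Phi> (\<lambda>r. r < 1) *v x 0 - stable_part \<Phi> \<epsilon> 0 \<and>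
    vl = mod_proj \<Phi> (\<lambda>r. r > 1) *v x 0 + unstable_part \<Phi> \<epsilon> 0 \<and>
    vu = mod_proj \<Phi> (\<lambda>r. r = 1) *v x 0"
proof (intro iffI)
  assume "solution_formulas \<Phi> \<epsilon> x vr vl vu"
  then have vu: "mod_proj \<Phi> (\<lambda>r. r = 1) *v vu = vu"
    and S: "mod_proj \<Phi> (\<lambda>r. r < 1) *v x 0 = matpow_int \<Phi> 0 *v vr + stable_part \<Phi> \<epsilon> 0"
    and U: "mod_proj \<Phi> (\<lambda>r. r > 1) *v x 0 = matpow_int \<Phi> 0 *v vl - unstable_part \<Phi> \<epsilon> 0"
    and C: "complex_vec (mod_proj \<Phi> (\<lambda>r. r = 1) *v x 0) = unit_part \<Phi> \<epsilon> vu 0"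
    unfolding solution_formulas_alt by auto
  have "vu = mod_proj \<Phi> (\<lambda>r. r = 1) *v x 0"
    using C by (simp add: unit_part_recurrence(2) vu)
  then show "vr = mod_proj \<Phi> (\<lambda>r. r < 1) *v x 0 - stable_part \<Phi> \<epsilon> 0 \<and>
    vl = mod_proj \<Phi> (\<lambda>r. r > 1) *v x 0 + unstable_part \<Phi> \<epsilon> 0 \<and>
    vu = mod_proj \<Phi> (\<lambda>r. r = 1) *v x 0"
    by (simp add: S U matpow_int_def)
next
  assume "vr = mod_proj \<Phi> (\<lambda>r. r < 1) *v x 0 - stable_part \<Phi> \<epsilon> 0 \<and>
    vl = mod_proj \<Phi> (\<lambda>r. r > 1) *v x 0 + unstable_part \<Phi> \<epsilon> 0 \<and>
    vu = mod_proj \<Phi> (\<lambda>r. r = 1) *v x 0"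
  moreover have "solution_formulas \<Phi> \<epsilon> x
      (mod_proj \<Phi> (\<lambda>r. r < 1) *v x 0 - stable_part \<Phi> \<epsilon> 0)
      (mod_proj \<Phi> (\<lambda>r. r > 1) *v x 0 + unstable_part \<Phi> \<epsilon> 0)
      (mod_proj \<Phi> (\<lambda>r. r = 1) *v x 0)"
    unfolding solution_formulas_alt
  proof (intro conjI allI)
    show "mod_proj \<Phi> (\<lambda>r. r = 1) *v (mod_proj \<Phi> (\<lambda>r. r = 1) *v x 0) = mod_proj \<Phi> (\<lambda>r. r = 1) *v x 0"
      by (simp add: mod_proj_mult_vec)
  qed (rule stable_solution[of \<epsilon> x \<Phi>, OF \<epsilon> x] unstable_solution[of \<epsilon> x \<Phi>, OF \<epsilon> x]
      unit_solution[of x \<Phi> \<epsilon>, OF x])+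
  ultimately show "solution_formulas \<Phi> \<epsilon> x vr vl vu" by (elim conjE) (simp only:)
qed

theorem theorem1:
  fixes \<Phi> :: "real ^ 'n ^ 'n" and \<epsilon> x :: "int \<Rightarrow> real ^ 'n"
  assumes "subexponential \<epsilon>"
  shows "(\<forall>t. x t = proj_lt1 \<Phi> *v x t + proj_left \<Phi> *v x t + proj_unit \<Phi> *v x t) \<and>
    (\<forall>t. summable (\<lambda>k. matpow \<Phi> k *v (proj_lt1 \<Phi> *v \<epsilon> (t - int k)))) \<and>
    (\<forall>t. summable (\<lambda>k. matpow_int \<Phi> (- int (Suc k)) *v (proj_left \<Phi> *v \<epsilon> (t + int (Suc k))))) \<and>
    ((\<forall>t. x t = \<Phi> *v x (t - 1) + \<epsilon> t) \<longleftrightarrow> (\<exists>vr vl vu. solution_formulas \<Phi> \<epsilon> x vr vl vu)) \<and>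
    ((\<forall>t. x t = \<Phi> *v x (t - 1) + \<epsilon> t) \<longrightarrow>
      convergent (\<lambda>n. matpow \<Phi> n *v (proj_right \<Phi> *v x (- int n))) \<and>
      convergent (\<lambda>n. matpow_int \<Phi> (- int n) *v (proj_left \<Phi> *v x (int n))) \<and>
      (\<forall>vr vl vu. solution_formulas \<Phi> \<epsilon> x vr vl vu \<longleftrightarrow>
         vr = lim (\<lambda>n. matpow \<Phi> n *v (proj_right \<Phi> *v x (- int n))) \<and>
         vl = lim (\<lambda>n. matpow_int \<Phi> (- int n) *v (proj_left \<Phi> *v x (int n))) \<and>
         vu = proj_unit \<Phi> *v x 0) \<and>
      (subexponential x \<longrightarrow>
         (\<forall>vr vl vu. solution_formulas \<Phi> \<epsilon> x vr vl vu \<longrightarrow> vr = 0 \<and> vl = 0)))"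
proof -
  \<comment> \<open>At \<open>n = 0\<close> \<open>matpow_int\<close> takes the branch of
    nonnegative powers, hence the case split.\<close>
  have pow: "matpow_int \<Phi> (- int n) = matpow (drazin \<Phi>) n" for n
    by (cases n) (simp_all add: matpow_int_def nat_add_distrib del: matpow.simps(2))
  let ?r = "\<lambda>n. matpow \<Phi> n *v (mod_proj \<Phi> (\<lambda>r. 0 < r \<and> r < 1) *v x (- int n))"
  let ?l = "\<lambda>n. matpow (drazin \<Phi>) n *v (mod_proj \<Phi> (\<lambda>r. r > 1) *v x (int n))"
  have limits: "convergent ?r \<and> convergent ?l \<and>
      (\<forall>vr vl vu. solution_formulas \<Phi> \<epsilon> x vr vl vu \<longleftrightarrow>
         vr = lim ?r \<and> vl = lim ?l \<and> vu = mod_proj \<Phi> (\<lambda>r. r = 1) *v x 0) \<and>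
      (subexponential x \<longrightarrow>
         (\<forall>vr vl vu. solution_formulas \<Phi> \<epsilon> x vr vl vu \<longrightarrow> vr = 0 \<and> vl = 0))"
    if x: "\<forall>t. x t = \<Phi> *v x (t - 1) + \<epsilon> t"
  proof -
    have x: "x t = \<Phi> *v x (t - 1) + \<epsilon> t" for t using x by blast
    have iff: "solution_formulas \<Phi> \<epsilon> x vr vl vu \<longleftrightarrow>
        vr = lim ?r \<and> vl = lim ?l \<and> vu = mod_proj \<Phi> (\<lambda>r. r = 1) *v x 0" for vr vl vu
      using solution_formulas_iff[of \<epsilon> x \<Phi>, OF assms x]
      by (simp only: limI[OF stable_limit[OF assms x]] limI[OF unstable_limit[OF assms x]])
    \<comment> \<open>Claim (iv): the limits that give the vectors in (iii) are 0 because
      exponential decay beats subexponential growth of \<open>x\<close>.\<close>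
    have "lim ?r = 0 \<and> lim ?l = 0" if "subexponential x"
      using that by (auto intro: limI stable_limit_subexponential unstable_limit_subexponential)
    with iff show ?thesis
      using convergentI[OF stable_limit[OF assms x]] convergentI[OF unstable_limit[OF assms x]]
      by simp
  qed
  have iff: "(\<forall>t. x t = \<Phi> *v x (t - 1) + \<epsilon> t) \<longleftrightarrow> (\<exists>vr vl vu. solution_formulas \<Phi> \<epsilon> x vr vl vu)"
  proof
    assume "\<forall>t. x t = \<Phi> *v x (t - 1) + \<epsilon> t"
    from solution_formulas_iff[of \<epsilon> x \<Phi>, OF assms this[rule_format]]
    show "\<exists>vr vl vu. solution_formulas \<Phi> \<epsilon> x vr vl vu" by simp
  next
    assume "\<exists>vr vl vu. solution_formulas \<Phi> \<epsilon> x vr vl vu"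
    then show "\<forall>t. x t = \<Phi> *v x (t - 1) + \<epsilon> t"
      by (elim exE) (intro allI solution_formulas_imp_recurrence[OF assms])
  qed
  have decomp: "\<forall>t. x t = mod_proj \<Phi> (\<lambda>r. r < 1) *v x t + mod_proj \<Phi> (\<lambda>r. r > 1) *v x t +
      mod_proj \<Phi> (\<lambda>r. r = 1) *v x t"
    by (intro allI mod_proj_decomposition)
  show ?thesis
    unfolding proj_eq_mod_proj pow
    by (intro conjI decomp iff allI stable_summable[OF assms] unstable_summable[OF assms])
      (intro impI limits)
qed

end
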